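(* Let $N\ge1$, let $M\in\mathrm{Mat}_{N+1}(k)$ be a nonzero matrix, and let $0=S_0\subset S_1\subset\cdots\subset S_{N+1}=k^{N+1}$ be the standard flag. The facets of the corner polyhedron $\Pi_+(M)$, described by their associated supporting halfspaces, are exactly the ones listed below. For each nonempty subset $I=\{i_1,\ldots,i_\gamma\}\subseteq\{1,\ldots,N\}$, where $\gamma=\#I$ and $0=i_0<i_1<\cdots<i_\gamma<i_{\gamma+1}=N+1$, there is at most one facet. If $M$ is not strictly upper triangular: - (F-1A): if $\gamma=1$ and $MS_{i_1}\subseteq S_{i_1}$, there is a facet $\{s_I\ge0\}$. - (F-1B): if $h_{M,I}(t)=t+1$ for all $1\le t\le\gamma$, there is a facet $\{s_I\ge-1\}$. If $M$ is strictly upper triangular: - (F-2A): if $\gamma=1$ and ($MS_{N+1}\not\subseteq S_{i_1}$ or $MS_{i_1}\ne0$), there is a facet $\{s_I\ge0\}$. - (F-2B): if $h_{M,I}(t)=t-1$ for all $1\le t\le\gamma+1$, there is a facet $\{s_I\ge1\}$.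
   Context: $k$ is an algebraically closed field. Let $\bar W\subset\mathbb{R}^{N+1}$ be the hyperplane of vectors whose coordinates sum to $0$; $e_1,\ldots,e_{N+1}$ are the standard basis vectors of $\mathbb{R}^{N+1}$. For $1\le j\le N$ let $s_j(x)=x_1+\cdots+x_j$; the $s_j$ form a basis of the dual of $\bar W$. Let $O^+=\{w\in\bar W: s_j(w)\ge0\ \forall j\}$. The corner polyhedron of a nonzero $M=(M_{ij})$ is $$\Pi_+(M)=\mathrm{Conv}\{e_i-e_j: M_{ij}\ne0\}+O^+\subset\bar W$$ (Minkowski sum); it is an $N$-dimensional polyhedron in the $N$-dimensional space $\bar W$. A facet is a face of dimension $N-1$; each facet has a unique associated supporting closed halfspace. For nonempty $I\subseteq\{1,\ldots,N\}$, $s_I=\sum_{i\in I}s_i$, and $\{s_I\ge c\}=\{w\in\bar W: s_I(w)\ge c\}$. The standard flag: $S_\rho$ is the span of the first $\rho$ standard basis vectors of $k^{N+1}$. For $I$ as in the statement, the Hessenberg function of $M$ with respect to the subflag $0=S_{i_0}\subsetneq S_{i_1}\subsetneq\cdots\subsetneq S_{i_\gamma}\subsetneq S_{i_{\gamma+1}}=k^{N+1}$ is $$h_{M,I}:\{0,\ldots,\gamma+1\}\to\{0,\ldots,\gamma+1\},\qquad t\mapsto\min\{t': MS_{i_t}\subseteq S_{i_{t'}}\}.$$ *)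

theory Defs
  imports "HOL-Analysis.Analysis" "HOL-Computational_Algebra.Polynomial"
begin

text \<open>
  The coordinates of both \<open>\<real>\<^sup>N\<^sup>+\<^sup>1\<close> and \<open>k\<^sup>N\<^sup>+\<^sup>1\<close> are indexed by a finite linearly ordered type
  \<open>'n\<close> with \<open>CARD('n) = N + 1\<close>; \<open>pos\<close> is its order isomorphism onto \<open>{1..N + 1}\<close>.
\<close>

definition pos :: "'n::{finite,linorder} \<Rightarrow> nat" where
  "pos i = card {j. j \<le> i}"

definition Wbar :: "(real ^ 'n::{finite,linorder}) set" where
  "Wbar = {w. (\<Sum>i\<in>UNIV. w $ i) = 0}"

definition s_coord :: "nat \<Rightarrow> real ^ 'n::{finite,linorder} \<Rightarrow> real" where
  "s_coord j w = (\<Sum>i | pos i \<le> j. w $ i)"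

definition s_sum :: "nat set \<Rightarrow> real ^ 'n::{finite,linorder} \<Rightarrow> real" where
  "s_sum I w = (\<Sum>j\<in>I. s_coord j w)"

definition s_halfspace :: "nat set \<Rightarrow> real \<Rightarrow> (real ^ 'n::{finite,linorder}) set" where
  "s_halfspace I c = {w \<in> Wbar. s_sum I w \<ge> c}"

text \<open>\<open>CARD('n) - 1\<close> is \<open>N\<close>; \<open>s_coord (N + 1)\<close> vanishes on \<open>Wbar\<close>.\<close>

definition O_plus :: "(real ^ 'n::{finite,linorder}) set" where
  "O_plus = {w \<in> Wbar. \<forall>j\<in>{1..CARD('n) - 1}. s_coord j w \<ge> 0}"

text \<open>The sum of sets below is the Minkowski sum.\<close>

definition corner_polyhedron ::
  "'k::field ^ 'n::{finite,linorder} ^ 'n::{finite,linorder} \<Rightarrow> (real ^ 'n::{finite,linorder}) set" where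
  "corner_polyhedron M = convex hull {axis i 1 - axis j 1 | i j. M $ i $ j \<noteq> 0} + O_plus"

text \<open>
  \<open>H\<close> is a closed halfspace of the space \<open>Wbar\<close> (not of the ambient \<open>\<real>\<^sup>N\<^sup>+\<^sup>1\<close>) that contains \<open>P\<close>
  and whose bounding hyperplane cuts out the face \<open>F\<close>. The normal \<open>a\<close> is only determined
  modulo constant vectors, hence the condition that it is nonzero as a functional on \<open>Wbar\<close>.
\<close>

definition supporting_halfspace ::
  "(real ^ 'n::{finite,linorder}) set \<Rightarrow> (real ^ 'n::{finite,linorder}) set \<Rightarrow> (real ^ 'n::{finite,linorder}) set \<Rightarrow> bool" where
  "supporting_halfspace P F H \<longleftrightarrow>
     (\<exists>a c. (\<exists>w\<in>Wbar. a \<bullet> w \<noteq> 0) \<and> H = {w \<in> Wbar. a \<bullet> w \<ge> c} \<and>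
            P \<subseteq> H \<and> F = P \<inter> {w. a \<bullet> w = c})"

definition std_flag :: "nat \<Rightarrow> ('k::field ^ 'n::{finite,linorder}) set" where
  "std_flag \<rho> = vec.span {axis i 1 | i. pos i \<le> \<rho>}"

text \<open>For \<open>I = {i\<^sub>1 < \<dots> < i\<^sub>\<gamma>} \<subseteq> {1..N}\<close>, the index \<open>i\<^sub>t\<close> with \<open>i\<^sub>0 = 0\<close> and \<open>i\<^sub>\<gamma>\<^sub>+\<^sub>1 = N + 1 = m\<close>.\<close>

definition subflag_index :: "nat \<Rightarrow> nat set \<Rightarrow> nat \<Rightarrow> nat" where
  "subflag_index m I t = sorted_list_of_set ({0} \<union> I \<union> {m}) ! t"

definition subflag :: "nat set \<Rightarrow> nat \<Rightarrow> ('k::field ^ 'n::{finite,linorder}) set" where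
  "subflag I t = std_flag (subflag_index CARD('n) I t)"

definition hessenberg :: "'k::field ^ 'n::{finite,linorder} ^ 'n::{finite,linorder} \<Rightarrow> nat set \<Rightarrow> nat \<Rightarrow> nat" where
  "hessenberg M I t =
     (LEAST t'. t' \<le> card I + 1 \<and> (*v) M ` subflag I t \<subseteq> subflag I t')"

definition strictly_upper_triangular :: "'k::field ^ 'n::{finite,linorder} ^ 'n::{finite,linorder} \<Rightarrow> bool" where
  "strictly_upper_triangular M \<longleftrightarrow> (\<forall>i j. j \<le> i \<longrightarrow> M $ i $ j = 0)"

end

theory Submission
  imports Defs
begin

text \<open>
  A halfspace \<open>a \<bullet> w \<ge> c\<close> contains the corner polyhedron iff the coordinates of \<open>a\<close> are
  nonincreasing and \<open>a\<^sub>i - a\<^sub>j \<ge> c\<close> whenever \<open>M\<^sub>i\<^sub>j \<noteq> 0\<close>. The face it cuts out is a facet iff \<open>a\<close> is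
  rigid: every \<open>b\<close> that is constant on the level sets of \<open>a\<close> and has one common difference
  \<open>b\<^sub>i - b\<^sub>j\<close> on the tight nonzero entries is an affine function of \<open>a\<close>.

  Testing rigidity against 0/1 vectors determines \<open>a\<close>. For \<open>c = 0\<close> every function of \<open>a\<close> is an
  admissible \<open>b\<close>, so \<open>a\<close> has only two values. For \<open>c = \<plusminus>1\<close>, normalising the last coordinate of
  \<open>a\<close> to \<open>0\<close>, the indicator of integrality shows that \<open>a\<close> is integral, and indicators of
  superlevel sets show that its values are consecutive and that each two neighbouring values are
  linked by a tight entry. So \<open>a\<close> represents some \<open>s\<^sub>I\<close>, and in terms of the position of an index
  relative to \<open>I\<close> the links say precisely that the Hessenberg function is \<open>t + 1\<close> or \<open>t - 1\<close>.
\<close>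

subsection \<open>Halfspaces containing the corner polyhedron\<close>

lemma pos_le_iff [simp]: "pos i \<le> pos j \<longleftrightarrow> i \<le> (j :: 'n::{finite,linorder})"
proof
  show "pos i \<le> pos j" if "i \<le> j"
    unfolding pos_def using that by (intro card_mono) auto
  show "i \<le> j" if "pos i \<le> pos j"
  proof (rule ccontr)
    assume "\<not> i \<le> j"
    then have "{k. k \<le> j} \<subset> {k. k \<le> i}" by force
    then have "pos j < pos i"
      unfolding pos_def by (intro psubset_card_mono) auto
    with that show False by simp
  qed
qed

lemma bij_betw_pos: "bij_betw pos (UNIV :: 'n::{finite,linorder} set) {1..CARD('n)}"
proof -
  have inj: "inj (pos :: 'n \<Rightarrow> nat)"
    by (intro injI) (metis antisym order_refl pos_le_iff)
  have "pos i \<in> {1..CARD('n)}" for i :: 'n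
    unfolding pos_def using card_gt_0_iff[of "{j. j \<le> i}"]
    by (auto intro!: card_mono simp: Suc_le_eq)
  then have "range (pos :: 'n \<Rightarrow> nat) = {1..CARD('n)}"
    by (intro card_subset_eq) (auto simp: card_image[OF inj])
  with inj show ?thesis by (simp add: bij_betw_def)
qed

lemma pos_ge_1: "1 \<le> pos i" and pos_le_card: "pos i \<le> CARD('n)" for i :: "'n::{finite,linorder}"
  using bij_betw_pos[where 'n = 'n] by (auto dest!: bij_betwE)

lemma pos_surj:
  assumes "1 \<le> l" "l \<le> CARD('n)"
  obtains i :: "'n::{finite,linorder}" where "pos i = l"
  using bij_betw_pos[where 'n = 'n] assms
  by (metis atLeastAtMost_iff bij_betw_imp_surj_on imageE)

text \<open>Summation by parts as an induction: going from \<open>n\<close> to \<open>Suc n\<close>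
  lowers the factor of the nonnegative partial sum from \<open>g n\<close> to
  \<open>g (Suc n)\<close>, and the new term is the same on both sides.\<close>

lemma abel_sum_ge:
  fixes g x :: "nat \<Rightarrow> real"
  assumes "1 \<le> n"
    and "\<And>k. 1 \<le> k \<Longrightarrow> k < n \<Longrightarrow> g (Suc k) \<le> g k"
    and "\<And>k. 1 \<le> k \<Longrightarrow> k < n \<Longrightarrow> 0 \<le> (\<Sum>i=1..k. x i)"
  shows "g n * (\<Sum>i=1..n. x i) \<le> (\<Sum>i=1..n. g i * x i)"
  using assms
proof (induction n rule: dec_induct)
  case base
  then show ?case by simp
next
  case (step n)
  have "g (Suc n) * (\<Sum>i=1..n. x i) \<le> g n * (\<Sum>i=1..n. x i)"
    using step by (intro mult_right_mono) auto
  also have "\<dots> \<le> (\<Sum>i=1..n. g i * x i)"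
    using step by auto
  finally show ?case
    using step by (simp add: algebra_simps)
qed

text \<open>Read in order of position, the partial sums of \<open>w\<close> are its coordinates
  \<open>s_coord\<close>, which are nonnegative on the cone. Summation by parts applies, and its
  boundary term vanishes because the coordinates of \<open>w\<close> sum to zero.\<close>

lemma inner_O_plus_nonneg:
  fixes a :: "real ^ 'n::{finite,linorder}"
  assumes "antimono (\<lambda>i. a $ i)" "w \<in> O_plus"
  shows "0 \<le> a \<bullet> w"
proof -
  define f :: "nat \<Rightarrow> 'n" where "f = inv pos"
  have f: "pos (f k) = k" if "1 \<le> k" "k \<le> CARD('n)" for k
    using pos_surj[OF that] unfolding f_def by (metis f_inv_into_f rangeI)
  have pf: "f (pos i) = i" for i
    unfolding f_def using bij_betw_pos by (metis bij_betw_def inv_f_f)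
  have partial: "(\<Sum>k=1..m. w $ f k) = s_coord m w" if "m \<le> CARD('n)" for m
    unfolding s_coord_def
    by (rule sum.reindex_bij_witness[of _ pos f])
       (use f pf pos_ge_1 that in auto)
  have total: "(\<Sum>k=1..CARD('n). h (f k)) = (\<Sum>i\<in>UNIV. h i)" for h :: "'n \<Rightarrow> real"
    by (rule sum.reindex_bij_witness[of _ pos f])
       (use f pf pos_ge_1 pos_le_card in auto)
  have "a $ f CARD('n) * (\<Sum>k=1..CARD('n). w $ f k) \<le> (\<Sum>k=1..CARD('n). a $ f k * w $ f k)"
  proof (rule abel_sum_ge)
    fix k assume k: "1 \<le> k" "k < CARD('n)"
    then have "f k \<le> f (Suc k)"
      by (subst pos_le_iff[symmetric]) (simp add: f)
    with assms(1) show "a $ f (Suc k) \<le> a $ f k" by (rule antimonoD)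
    show "0 \<le> (\<Sum>i=1..k. w $ f i)"
      using assms(2) k partial[of k] by (auto simp: O_plus_def)
  qed simp
  also have "(\<Sum>k=1..CARD('n). w $ f k) = 0"
    using assms(2) total[of "\<lambda>i. w $ i"] by (simp add: O_plus_def Wbar_def)
  also have "(\<Sum>k=1..CARD('n). a $ f k * w $ f k) = a \<bullet> w"
    using total[of "\<lambda>i. a $ i * w $ i"] by (simp add: inner_vec_def)
  finally show ?thesis by simp
qed

section \<open>Differences of basis vectors, the cone and the polyhedron\<close>

lemma inner_root: "a \<bullet> (axis i 1 - axis j 1) = a $ i - a $ j" for a :: "real ^ 'n"
  by (simp add: inner_diff_right inner_axis)

lemma Wbar_eq_inner: "Wbar = {w. 1 \<bullet> w = 0}"
  by (simp add: Wbar_def inner_vec_def)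

lemma subspace_Wbar: "subspace (Wbar :: (real ^ 'n::{finite,linorder}) set)"
  unfolding Wbar_eq_inner by (rule subspace_hyperplane)

lemma root_in_Wbar: "axis i 1 - axis j 1 \<in> Wbar"
  by (simp add: Wbar_eq_inner inner_root)

lemma s_coord_inner: "s_coord l w = (\<chi> i. of_bool (pos i \<le> l)) \<bullet> w"
  by (simp add: s_coord_def inner_vec_def of_bool_def if_distrib[of "\<lambda>x. x * _"] sum.If_cases)

text \<open>On the difference of basis vectors, \<open>s_coord l\<close> is 1 if
  \<open>pos i \<le> l < pos j\<close> and 0 otherwise. These rays are the test directions that
  detect whether a functional is nonincreasing or constant.\<close>

lemma scaled_root_in_O_plus:
  assumes "i \<le> j" "0 \<le> t"
  shows "t *\<^sub>R (axis i 1 - axis j 1) \<in> O_plus"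
proof -
  have "pos i \<le> pos j" using assms by simp
  then have "pos i \<le> l" if "pos j \<le> l" for l using that by (rule order_trans)
  then show ?thesis
    using assms subspace_mul[OF subspace_Wbar root_in_Wbar]
    by (auto simp: O_plus_def s_coord_inner inner_root)
qed

lemma zero_in_O_plus: "0 \<in> O_plus"
  using scaled_root_in_O_plus[of _ _ 0] by auto

lemma convex_O_plus: "convex (O_plus :: (real ^ 'n::{finite,linorder}) set)"
proof -
  have "O_plus = (Wbar :: (real, 'n) vec set) \<inter> (\<Inter>l\<in>{1..CARD('n) - 1}. {w. s_coord l w \<ge> 0})"
    unfolding O_plus_def by auto
  moreover have "convex \<dots>"
    unfolding s_coord_inner
    by (intro convex_Int convex_INT subspace_imp_convex[OF subspace_Wbar] convex_halfspace_ge)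
  ultimately show ?thesis by simp
qed

lemma convex_corner: "convex (corner_polyhedron M)"
  unfolding corner_polyhedron_def by (intro convex_set_plus convex_convex_hull convex_O_plus)

lemma corner_plus_O_plus:
  assumes "x \<in> corner_polyhedron M" "o' \<in> O_plus"
  shows "x + o' \<in> corner_polyhedron M"
proof -
  obtain y z where "x = y + z" "y \<in> convex hull {axis i 1 - axis j 1 | i j. M $ i $ j \<noteq> 0}" "z \<in> O_plus"
    using assms(1) unfolding corner_polyhedron_def by (rule set_plus_elim)
  moreover have "z + o' \<in> O_plus"
    using \<open>z \<in> O_plus\<close> assms(2) subspace_add[OF subspace_Wbar, of z o']
    by (auto simp: O_plus_def s_coord_inner inner_add_right)
  ultimately show ?thesis
    unfolding corner_polyhedron_def by (auto simp: add.assoc)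
qed

lemma root_in_corner: "M $ i $ j \<noteq> 0 \<Longrightarrow> axis i 1 - axis j 1 \<in> corner_polyhedron M"
  unfolding corner_polyhedron_def
  using set_plus_intro[OF hull_inc zero_in_O_plus, of "axis i 1 - axis j 1"
      "{axis i 1 - axis j 1 | i j. M $ i $ j \<noteq> 0}" convex] by auto

text \<open>On the hull a functional is bounded by its values at the generators, and on the cone a
  nonincreasing one is nonnegative. Conversely, an ascent of \<open>a\<close> makes it unbounded
  below along a ray of the cone based at a generator, which exists because \<open>M\<close> is
  nonzero.\<close>

lemma corner_subset_halfspace_iff:
  assumes "M \<noteq> 0"
  shows "corner_polyhedron M \<subseteq> {w. a \<bullet> w \<ge> c} \<longleftrightarrow>
    antimono (\<lambda>i. a $ i) \<and> (\<forall>i j. M $ i $ j \<noteq> 0 \<longrightarrow> c \<le> a $ i - a $ j)"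
proof (intro iffI conjI)
  assume sub: "corner_polyhedron M \<subseteq> {w. a \<bullet> w \<ge> c}"
  then show "\<forall>i j. M $ i $ j \<noteq> 0 \<longrightarrow> c \<le> a $ i - a $ j"
    using root_in_corner by (fastforce simp flip: inner_root)
  obtain p q where pq: "M $ p $ q \<noteq> 0"
    using assms by (metis vec_eq_iff zero_index)
  show "antimono (\<lambda>i. a $ i)"
  proof (rule antimonoI, rule ccontr)
    fix i j :: 'b assume ij: "i \<le> j" "\<not> a $ j \<le> a $ i"
    \<comment> \<open>Far enough along the ray for the loss \<open>t * (a $ j - a $ i)\<close> to
      exceed the slack of the base point by at least 1.\<close>
    define t where "t = (\<bar>a $ p - a $ q - c\<bar> + 1) / (a $ j - a $ i)"
    have "0 \<le> t" using ij by (simp add: t_def)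
    then have "c \<le> a \<bullet> ((axis p 1 - axis q 1) + t *\<^sub>R (axis i 1 - axis j 1))"
      using sub corner_plus_O_plus[OF root_in_corner[OF pq] scaled_root_in_O_plus[OF ij(1)]] by blast
    then have "t * (a $ j - a $ i) \<le> a $ p - a $ q - c"
      by (simp only: inner_add_right inner_root inner_scaleR_right) (simp add: algebra_simps)
    then show False using ij by (simp add: t_def)
  qed
next
  assume a: "antimono (\<lambda>i. a $ i) \<and> (\<forall>i j. M $ i $ j \<noteq> 0 \<longrightarrow> c \<le> a $ i - a $ j)"
  have "convex hull {axis i 1 - axis j 1 | i j. M $ i $ j \<noteq> 0} \<subseteq> {w. a \<bullet> w \<ge> c}"
    using a by (intro hull_minimal convex_halfspace_ge) (auto simp: inner_root)
  then show "corner_polyhedron M \<subseteq> {w. a \<bullet> w \<ge> c}"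
    unfolding corner_polyhedron_def
    using a by (fastforce elim!: set_plus_elim simp: inner_add_right dest: inner_O_plus_nonneg)
qed

lemma corner_subset_Wbar: "corner_polyhedron M \<subseteq> Wbar"
proof -
  have "convex hull {axis i 1 - axis j 1 | i j. M $ i $ j \<noteq> 0} \<subseteq> Wbar"
    by (intro hull_minimal subspace_imp_convex[OF subspace_Wbar]) (auto simp: root_in_Wbar)
  then show ?thesis
    unfolding corner_polyhedron_def
    by (auto elim!: set_plus_elim intro!: subspace_add[OF subspace_Wbar] simp: O_plus_def)
qed

subsection \<open>Rigidity of facet normals\<close>

text \<open>For nonempty \<open>S\<close> this is the orthogonal complement of the direction space
  of the affine hull. It trades statements about affine dimension for linear algebra on
  normals.\<close>

definition affine_annihilator :: "'a::real_inner set \<Rightarrow> 'a set" where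
  "affine_annihilator S = {b. \<exists>d. \<forall>x\<in>S. b \<bullet> x = d}"

lemma affine_annihilator_eq:
  assumes "x \<in> S"
  shows "affine_annihilator S = {b. \<forall>y\<in>(+) (- x) ` S. orthogonal y b}"
proof -
  have "(\<exists>d. \<forall>y\<in>S. b \<bullet> y = d) \<longleftrightarrow> (\<forall>y\<in>S. b \<bullet> y = b \<bullet> x)" for b
    using assms by metis
  moreover have "orthogonal (- x + y) b \<longleftrightarrow> b \<bullet> y = b \<bullet> x" for y b
    by (simp only: orthogonal_commute[of _ b]) (auto simp: orthogonal_def inner_diff_right)
  ultimately show ?thesis
    by (simp only: affine_annihilator_def ball_simps)
qed

lemma subspace_affine_annihilator:
  assumes "S \<noteq> {}" shows "subspace (affine_annihilator S)"
proof -
  from assms obtain x where "x \<in> S" by blast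
  then show ?thesis
    by (simp only: affine_annihilator_eq subspace_orthogonal_to_vectors)
qed

text \<open>After translating a point of \<open>S\<close> to the origin, this is the dimension
  formula for a subspace and its orthogonal complement.\<close>

lemma aff_dim_add_dim_annihilator:
  fixes S :: "'a::euclidean_space set"
  assumes "S \<noteq> {}"
  shows "aff_dim S + int (dim (affine_annihilator S)) = int DIM('a)"
proof -
  from assms obtain x where x: "x \<in> S" by blast
  let ?D = "(+) (- x) ` S"
  have "dim {y \<in> UNIV. \<forall>z \<in> span ?D. orthogonal z y} + dim (span ?D) = dim (UNIV :: 'a set)"
    by (intro dim_subspace_orthogonal_to_vectors) auto
  moreover have "{y \<in> UNIV. \<forall>z \<in> span ?D. orthogonal z y} = affine_annihilator S"
    unfolding affine_annihilator_eq[OF x]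
  proof (intro Collect_cong iffI conjI ballI UNIV_I)
    show "orthogonal z y" if "\<forall>z\<in>?D. orthogonal z y" "z \<in> span ?D" for y z
      using that orthogonal_to_span[of z ?D y] by (metis orthogonal_commute)
  qed (blast intro: span_base)
  moreover have "aff_dim S = int (dim ?D)"
    by (intro aff_dim_eq_dim hull_inc x)
  ultimately show ?thesis by simp
qed

text \<open>The all-ones vector vanishes on \<open>Wbar\<close>. Normals therefore matter only
  modulo \<open>1\<close>, and \<open>1\<close> occurs in every span below.\<close>

lemma one_in_annihilator: "S \<subseteq> Wbar \<Longrightarrow> 1 \<in> affine_annihilator S"
  by (auto simp: affine_annihilator_def Wbar_eq_inner)

lemma span_one: "b \<in> span {1} \<longleftrightarrow> (\<exists>m. \<forall>i. b $ i = m)" for b :: "real ^ 'n"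
  by (auto simp: span_singleton vec_eq_iff)

lemma span_one_insert: "b \<in> span {a, 1} \<longleftrightarrow> (\<exists>l m. \<forall>i. b $ i = l * a $ i + m)" for a b :: "real ^ 'n"
  by (simp add: span_breakdown_eq span_singleton vec_eq_iff image_iff diff_eq_eq add.commute)

text \<open>A functional constant on the polyhedron is constant along every cone direction, so its
  coordinates are all equal. The annihilator is the line spanned by \<open>1\<close>.\<close>

lemma aff_dim_corner:
  fixes M :: "'k::field ^ 'n::{finite,linorder} ^ 'n::{finite,linorder}"
  assumes "M \<noteq> 0"
  shows "aff_dim (corner_polyhedron M) = int CARD('n) - 1"
proof -
  obtain p q where pq: "M $ p $ q \<noteq> 0"
    using assms by (metis vec_eq_iff zero_index)
  have "b $ i = b $ j" if "b \<in> affine_annihilator (corner_polyhedron M)" for b i j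
  proof -
    have "b $ i = b $ j" if ij: "i \<le> j" for i j
    proof -
      have "b \<bullet> ((axis p 1 - axis q 1) + 1 *\<^sub>R (axis i 1 - axis j 1)) = b \<bullet> (axis p 1 - axis q 1)"
        using corner_plus_O_plus[OF root_in_corner[OF pq] scaled_root_in_O_plus[OF ij, of 1]]
          root_in_corner[OF pq] \<open>b \<in> _\<close>
        unfolding affine_annihilator_def by force
      then show ?thesis by (simp add: inner_add_right inner_root)
    qed
    then show ?thesis by (metis linear)
  qed
  then have "affine_annihilator (corner_polyhedron M) \<subseteq> span {1}"
    by (metis span_one subsetI)
  moreover have "span {1} \<subseteq> affine_annihilator (corner_polyhedron M)"
    using one_in_annihilator[OF corner_subset_Wbar, of M] root_in_corner[OF pq]
    by (intro span_minimal subspace_affine_annihilator) auto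
  ultimately have "affine_annihilator (corner_polyhedron M) = span {1}"
    by (rule subset_antisym)
  moreover have "1 \<noteq> (0 :: (real, 'n) vec)"
    by (simp add: vec_eq_iff)
  ultimately have "dim (affine_annihilator (corner_polyhedron M)) = 1"
    by (simp add: dim_insert)
  then show ?thesis
    using aff_dim_add_dim_annihilator[of "corner_polyhedron M"] root_in_corner[OF pq] by fastforce
qed

text \<open>The sum of all ratios serves as the multiple, since each ratio is one of its nonnegative
  summands. Where \<open>f\<close> vanishes so does \<open>g\<close>, and the ratio is 0 by the
  convention for division by zero.\<close>

lemma dominating_multiple:
  fixes f g :: "'a \<Rightarrow> real"
  assumes "finite S" "\<And>s. s \<in> S \<Longrightarrow> 0 \<le> f s" "\<And>s. s \<in> S \<Longrightarrow> f s = 0 \<Longrightarrow> g s = 0"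
  shows "\<exists>K. \<forall>s\<in>S. \<bar>g s\<bar> \<le> K * f s"
proof (intro exI[of _ "\<Sum>s\<in>S. \<bar>g s\<bar> / f s"] ballI)
  fix s assume s: "s \<in> S"
  show "\<bar>g s\<bar> \<le> (\<Sum>s\<in>S. \<bar>g s\<bar> / f s) * f s"
  proof (cases "f s = 0")
    case False
    then have "\<bar>g s\<bar> = \<bar>g s\<bar> / f s * f s" by simp
    also have "\<dots> \<le> (\<Sum>s\<in>S. \<bar>g s\<bar> / f s) * f s"
      using assms s by (intro mult_right_mono member_le_sum) auto
    finally show ?thesis .
  qed (use assms s in auto)
qed

text \<open>
  If \<open>b\<close> is compatible with the ties and the tight entries of \<open>a\<close>, then both \<open>K a + b\<close> and \<open>K a - b\<close>
  bound the polyhedron for large \<open>K\<close>; comparing them on the face pins down \<open>b\<close> there.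
\<close>

lemma constant_on_face:
  fixes M :: "'k::field ^ 'n::{finite,linorder} ^ 'n::{finite,linorder}"
  assumes "M \<noteq> 0"
    and sub: "corner_polyhedron M \<subseteq> {w. a \<bullet> w \<ge> c}"
    and level: "\<And>i j. a $ i = a $ j \<Longrightarrow> b $ i = b $ j"
    and tight: "\<And>i j. M $ i $ j \<noteq> 0 \<Longrightarrow> a $ i - a $ j = c \<Longrightarrow> b $ i - b $ j = d"
    and x: "x \<in> corner_polyhedron M" "a \<bullet> x = c"
  shows "b \<bullet> x = d"
proof -
  have anti: "a $ j \<le> a $ i" if "i \<le> j" for i j
    using sub that unfolding corner_subset_halfspace_iff[OF \<open>M \<noteq> 0\<close>] by (blast dest: antimonoD)
  have edge: "c \<le> a $ i - a $ j" if "M $ i $ j \<noteq> 0" for i j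
    using sub that unfolding corner_subset_halfspace_iff[OF \<open>M \<noteq> 0\<close>] by blast
  have "\<exists>K1. \<forall>s\<in>{s. fst s \<le> snd s}. \<bar>b $ fst s - b $ snd s\<bar> \<le> K1 * (a $ fst s - a $ snd s)"
  proof (rule dominating_multiple)
    show "b $ fst s - b $ snd s = 0" if "a $ fst s - a $ snd s = 0" for s
      using that level[of "fst s" "snd s"] by simp
  qed (simp_all add: anti)
  then obtain K1 where K1: "\<And>i j. i \<le> j \<Longrightarrow> \<bar>b $ i - b $ j\<bar> \<le> K1 * (a $ i - a $ j)"
    by auto
  have "\<exists>K2. \<forall>s\<in>{s. M $ fst s $ snd s \<noteq> 0}.
      \<bar>b $ fst s - b $ snd s - d\<bar> \<le> K2 * (a $ fst s - a $ snd s - c)"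
  proof (rule dominating_multiple)
    show "b $ fst s - b $ snd s - d = 0"
      if "s \<in> {s. M $ fst s $ snd s \<noteq> 0}" "a $ fst s - a $ snd s - c = 0" for s
      using that tight[of "fst s" "snd s"] by simp
  qed (use edge in auto)
  then obtain K2
    where K2: "\<And>i j. M $ i $ j \<noteq> 0 \<Longrightarrow> \<bar>b $ i - b $ j - d\<bar> \<le> K2 * (a $ i - a $ j - c)"
    by auto
  \<comment> \<open>One multiple for both families of inequalities: enlarging \<open>K1\<close> or
    \<open>K2\<close> is harmless since the factors they multiply are nonnegative.\<close>
  define K where "K = max K1 K2"
  have K: "\<bar>b $ i - b $ j\<bar> \<le> K * (a $ i - a $ j)" if "i \<le> j" for i j
  proof -
    have "K1 * (a $ i - a $ j) \<le> K * (a $ i - a $ j)"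
      using anti[OF that] by (intro mult_right_mono) (auto simp: K_def)
    with K1[OF that] show ?thesis by simp
  qed
  have K': "\<bar>b $ i - b $ j - d\<bar> \<le> K * (a $ i - a $ j - c)" if "M $ i $ j \<noteq> 0" for i j
  proof -
    have "K2 * (a $ i - a $ j - c) \<le> K * (a $ i - a $ j - c)"
      using edge[OF that] by (intro mult_right_mono) (auto simp: K_def)
    with K2[OF that] show ?thesis by simp
  qed
  have "corner_polyhedron M \<subseteq> {w. (K *\<^sub>R a + b) \<bullet> w \<ge> K * c + d}"
    unfolding corner_subset_halfspace_iff[OF \<open>M \<noteq> 0\<close>]
  proof (intro conjI antimonoI allI impI)
    show "(K *\<^sub>R a + b) $ j \<le> (K *\<^sub>R a + b) $ i" if "i \<le> j" for i j
      using K[OF that] by (simp add: algebra_simps abs_le_iff)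
    show "K * c + d \<le> (K *\<^sub>R a + b) $ i - (K *\<^sub>R a + b) $ j" if "M $ i $ j \<noteq> 0" for i j
      using K'[OF that] by (simp add: algebra_simps abs_le_iff)
  qed
  moreover have "corner_polyhedron M \<subseteq> {w. (K *\<^sub>R a - b) \<bullet> w \<ge> K * c - d}"
    unfolding corner_subset_halfspace_iff[OF \<open>M \<noteq> 0\<close>]
  proof (intro conjI antimonoI allI impI)
    show "(K *\<^sub>R a - b) $ j \<le> (K *\<^sub>R a - b) $ i" if "i \<le> j" for i j
      using K[OF that] by (simp add: algebra_simps abs_le_iff)
    show "K * c - d \<le> (K *\<^sub>R a - b) $ i - (K *\<^sub>R a - b) $ j" if "M $ i $ j \<noteq> 0" for i j
      using K'[OF that] by (simp add: algebra_simps abs_le_iff)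
  qed
  \<comment> \<open>Substituting \<open>a \<bullet> x = c\<close>, the two bounds become
    \<open>b \<bullet> x \<ge> d\<close> and \<open>b \<bullet> x \<le> d\<close>.\<close>
  ultimately show ?thesis
    using x by (force simp: inner_add_left inner_diff_left)
qed

text \<open>Without a tight entry the tightness hypothesis of \<open>constant_on_face\<close> is
  vacuous, so \<open>a\<close> itself would take the value \<open>c + 1\<close> on the face, where
  it equals \<open>c\<close>.\<close>

lemma face_nonempty_iff:
  fixes M :: "'k::field ^ 'n::{finite,linorder} ^ 'n::{finite,linorder}"
  assumes "M \<noteq> 0" and sub: "corner_polyhedron M \<subseteq> {w. a \<bullet> w \<ge> c}"
  shows "corner_polyhedron M \<inter> {w. a \<bullet> w = c} \<noteq> {} \<longleftrightarrow> (\<exists>i j. M $ i $ j \<noteq> 0 \<and> a $ i - a $ j = c)"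
proof
  assume "\<exists>i j. M $ i $ j \<noteq> 0 \<and> a $ i - a $ j = c"
  then show "corner_polyhedron M \<inter> {w. a \<bullet> w = c} \<noteq> {}"
    using root_in_corner by (force simp flip: inner_root)
next
  assume "corner_polyhedron M \<inter> {w. a \<bullet> w = c} \<noteq> {}"
  then obtain x where x: "x \<in> corner_polyhedron M" "a \<bullet> x = c" by auto
  show "\<exists>i j. M $ i $ j \<noteq> 0 \<and> a $ i - a $ j = c"
  proof (rule ccontr)
    assume no: "\<not> ?thesis"
    then have "a \<bullet> x = c + 1"
      using constant_on_face[OF assms, of a "c + 1" x] x by blast
    with x show False by simp
  qed
qed

text \<open>The face is a facet iff it is nonempty and its annihilator has dimension 2. The
  annihilator always contains \<open>a\<close> and \<open>1\<close>, which are independent because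
  \<open>a\<close> is not constant.\<close>

lemma facet_iff_annihilator:
  fixes M :: "'k::field ^ 'n::{finite,linorder} ^ 'n::{finite,linorder}"
  assumes "M \<noteq> 0" and sub: "corner_polyhedron M \<subseteq> {w. a \<bullet> w \<ge> c}"
    and noncst: "\<exists>i j. a $ i \<noteq> a $ j"
  shows "(corner_polyhedron M \<inter> {w. a \<bullet> w = c}) facet_of corner_polyhedron M \<longleftrightarrow>
     corner_polyhedron M \<inter> {w. a \<bullet> w = c} \<noteq> {} \<and>
     affine_annihilator (corner_polyhedron M \<inter> {w. a \<bullet> w = c}) = span {a, 1}"
proof -
  let ?F = "corner_polyhedron M \<inter> {w. a \<bullet> w = c}"
  have face: "?F face_of corner_polyhedron M"
    using sub by (intro face_of_Int_supporting_hyperplane_ge convex_corner) auto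
  have "independent {a, 1}"
    using noncst by (simp add: independent_insert span_one vec_eq_iff) metis
  moreover have "a \<noteq> 1"
    using noncst by auto
  ultimately have dim2: "dim (span {a, 1}) = 2"
    by (simp add: dim_eq_card_independent)
  have "(aff_dim ?F = int CARD('n) - 1 - 1) \<longleftrightarrow> affine_annihilator ?F = span {a, 1}"
    if ne: "?F \<noteq> {}"
  proof -
    have "{a, 1} \<subseteq> affine_annihilator ?F"
      using one_in_annihilator[of ?F] corner_subset_Wbar[of M] by (auto simp: affine_annihilator_def)
    then have "span {a, 1} \<subseteq> affine_annihilator ?F"
      by (intro span_minimal subspace_affine_annihilator ne)
    then have "dim (affine_annihilator ?F) = 2 \<longleftrightarrow> affine_annihilator ?F = span {a, 1}"
      using dim2 subspace_dim_equal[OF subspace_span subspace_affine_annihilator[OF ne], of "{a, 1}"]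
      by (metis order_refl)
    then show ?thesis
      using aff_dim_add_dim_annihilator[OF ne] by auto
  qed
  then show ?thesis
    using face by (auto simp: facet_of_def aff_dim_corner[OF \<open>M \<noteq> 0\<close>])
qed

text \<open>The annihilator of the face is written in coordinates: \<open>constant_on_face\<close>
  shows that compatible vectors lie in it, and testing on points of the face gives the converse.
  Rigidity then says that it is no larger than \<open>span {a, 1}\<close>.\<close>

lemma facet_iff_rigid:
  fixes M :: "'k::field ^ 'n::{finite,linorder} ^ 'n::{finite,linorder}"
  assumes "M \<noteq> 0" and sub: "corner_polyhedron M \<subseteq> {w. a \<bullet> w \<ge> c}"
    and noncst: "\<exists>i j. a $ i \<noteq> a $ j"
  shows "(corner_polyhedron M \<inter> {w. a \<bullet> w = c}) facet_of corner_polyhedron M \<longleftrightarrow>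
     (\<exists>i j. M $ i $ j \<noteq> 0 \<and> a $ i - a $ j = c) \<and>
     (\<forall>b d. (\<forall>i j. a $ i = a $ j \<longrightarrow> b $ i = b $ j) \<and>
            (\<forall>i j. M $ i $ j \<noteq> 0 \<and> a $ i - a $ j = c \<longrightarrow> b $ i - b $ j = d) \<longrightarrow>
        (\<exists>l m. \<forall>i. b $ i = l * a $ i + m))"
    (is "?facet \<longleftrightarrow> ?tight \<and> ?rigid")
proof (cases ?tight)
  case True
  then obtain p q where pq: "M $ p $ q \<noteq> 0" "a $ p - a $ q = c" by blast
  let ?F = "corner_polyhedron M \<inter> {w. a \<bullet> w = c}"
  have ne: "?F \<noteq> {}"
    using True face_nonempty_iff[OF assms(1,2)] by blast
  have ann: "b \<in> affine_annihilator ?F \<longleftrightarrow>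
      (\<exists>d. (\<forall>i j. a $ i = a $ j \<longrightarrow> b $ i = b $ j) \<and>
            (\<forall>i j. M $ i $ j \<noteq> 0 \<and> a $ i - a $ j = c \<longrightarrow> b $ i - b $ j = d))" for b
  proof
    assume "b \<in> affine_annihilator ?F"
    then obtain d where d: "\<And>x. x \<in> ?F \<Longrightarrow> b \<bullet> x = d"
      by (auto simp: affine_annihilator_def)
    have tight: "b $ i - b $ j = d" if "M $ i $ j \<noteq> 0" "a $ i - a $ j = c" for i j
      using d[of "axis i 1 - axis j 1"] that root_in_corner[OF that(1)] by (simp add: inner_root)
    have le: "b $ i = b $ j" if "a $ i = a $ j" "i \<le> j" for i j
    proof -
      \<comment> \<open>Moving along a cone direction between indices tied under \<open>a\<close>
        does not change the value of \<open>a\<close>, so the point stays on the face.\<close>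
      have "(axis p 1 - axis q 1) + 1 *\<^sub>R (axis i 1 - axis j 1) \<in> ?F"
        using corner_plus_O_plus[OF root_in_corner[OF pq(1)] scaled_root_in_O_plus[OF that(2), of 1]] pq(2) that
        by (simp add: inner_add_right inner_root)
      from d[OF this] tight[OF pq] show ?thesis
        by (simp add: inner_add_right inner_root)
    qed
    have "b $ i = b $ j" if "a $ i = a $ j" for i j
      using linear[of i j] le[OF that] le[OF that[symmetric]] by fastforce
    with tight show "\<exists>d. (\<forall>i j. a $ i = a $ j \<longrightarrow> b $ i = b $ j) \<and>
            (\<forall>i j. M $ i $ j \<noteq> 0 \<and> a $ i - a $ j = c \<longrightarrow> b $ i - b $ j = d)"
      by blast
  next
    assume "\<exists>d. (\<forall>i j. a $ i = a $ j \<longrightarrow> b $ i = b $ j) \<and>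
            (\<forall>i j. M $ i $ j \<noteq> 0 \<and> a $ i - a $ j = c \<longrightarrow> b $ i - b $ j = d)"
    then obtain d where level: "\<And>i j. a $ i = a $ j \<Longrightarrow> b $ i = b $ j"
      and tight: "\<And>i j. M $ i $ j \<noteq> 0 \<Longrightarrow> a $ i - a $ j = c \<Longrightarrow> b $ i - b $ j = d"
      by blast
    have "b \<bullet> x = d" if "x \<in> ?F" for x
      by (rule constant_on_face[OF assms(1,2) level tight]) (use that in auto)
    then show "b \<in> affine_annihilator ?F"
      by (auto simp: affine_annihilator_def)
  qed
  have "span {a, 1} \<subseteq> affine_annihilator ?F"
    using one_in_annihilator[of ?F] corner_subset_Wbar[of M]
    by (intro span_minimal subspace_affine_annihilator ne) (auto simp: affine_annihilator_def)
  moreover have "?rigid \<longleftrightarrow> affine_annihilator ?F \<subseteq> span {a, 1}"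
    unfolding subset_iff ann span_one_insert by (simp only: all_simps ex_simps)
  ultimately have "?rigid \<longleftrightarrow> affine_annihilator ?F = span {a, 1}"
    by (simp only: set_eq_subset simp_thms)
  then show ?thesis
    unfolding facet_iff_annihilator[OF assms] by (simp only: True ne simp_thms)
next
  case False
  then have "corner_polyhedron M \<inter> {w. a \<bullet> w = c} = {}"
    using face_nonempty_iff[OF assms(1,2)] by blast
  with False show ?thesis
    unfolding facet_of_def by (simp only: simp_thms)
qed

subsection \<open>Step normals\<close>

text \<open>The number, counted from 0, of the block containing \<open>i\<close> when the positions
  are cut after each element of \<open>I\<close>: level \<open>t\<close> means that the position is
  above the \<open>t\<close>-th subflag index and at most the next one.\<close>

definition level :: "nat set \<Rightarrow> 'n::{finite,linorder} \<Rightarrow> nat" where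
  "level I i = card {l\<in>I. l < pos i}"

text \<open>The coefficient vector of \<open>s_sum I\<close>. Its last coordinate is 0 as soon as
  \<open>I\<close> omits the last position, which fixes the representative modulo constants.\<close>

definition step_normal :: "nat set \<Rightarrow> real ^ 'n::{finite,linorder}" where
  "step_normal I = (\<chi> i. real (card {l\<in>I. pos i \<le> l}))"

text \<open>Levels grow while the normal falls, so its difference between coordinates
  \<open>i\<close> and \<open>j\<close> is the level of \<open>j\<close> minus the level of
  \<open>i\<close>. This is the source of the reversed differences below.\<close>

lemma step_normal_level:
  assumes "finite I"
  shows "step_normal I $ i = real (card I) - real (level I i)"
proof -
  have "card I = card ({l\<in>I. pos i \<le> l} \<union> {l\<in>I. l < pos i})"
    by (rule arg_cong[where f = card]) auto
  also have "\<dots> = card {l\<in>I. pos i \<le> l} + level I i"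
    unfolding level_def using assms by (intro card_Un_disjoint) auto
  finally show ?thesis by (simp add: step_normal_def)
qed

lemma s_sum_inner:
  fixes w :: "real ^ 'n::{finite,linorder}"
  assumes "finite I"
  shows "s_sum I w = step_normal I \<bullet> w"
proof -
  have "(\<Sum>l\<in>I. \<chi> i. of_bool (pos i \<le> l)) = (step_normal I :: (real, 'n) vec)"
    using assms by (simp add: vec_eq_iff step_normal_def of_bool_def sum.If_cases Int_def)
  then show ?thesis
    unfolding s_sum_def s_coord_inner by (simp only: inner_sum_left[symmetric])
qed

lemma level_le: "finite I \<Longrightarrow> level I i \<le> card I"
  unfolding level_def by (intro card_mono) auto

text \<open>A discrete intermediate value argument: the number of elements of \<open>I\<close> below
  \<open>k\<close> rises from 0 to \<open>card I\<close> in steps of at most 1.\<close>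

lemma level_hit:
  assumes "I \<subseteq> {1..<CARD('n)}" "t \<le> card I"
  obtains i :: "'n::{finite,linorder}" where "level I i = t"
proof -
  have fin: "finite I" using assms(1) finite_subset by blast
  define f where "f k = int (card {l\<in>I. l < k})" for k
  have step: "\<bar>f (k + 1) - f k\<bar> \<le> 1" for k
  proof -
    have "{l\<in>I. l < k + 1} \<subseteq> insert k {l\<in>I. l < k}" by auto
    then have "card {l\<in>I. l < k + 1} \<le> card (insert k {l\<in>I. l < k})"
      using fin by (intro card_mono) auto
    also have "\<dots> \<le> Suc (card {l\<in>I. l < k})"
      by (rule card_insert_le_m1) auto
    finally have "card {l\<in>I. l < k + 1} \<le> Suc (card {l\<in>I. l < k})" .
    moreover have "card {l\<in>I. l < k} \<le> card {l\<in>I. l < k + 1}"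
      using fin by (intro card_mono) auto
    ultimately show ?thesis by (simp add: f_def)
  qed
  have "f CARD('n) = int (card I)"
    unfolding f_def using assms(1) by (auto intro!: arg_cong[where f = card])
  then obtain k where k: "k \<le> CARD('n)" "f k = int t"
    using nat0_intermed_int_val[of "CARD('n)" f "int t"] step assms(2) by (auto simp: f_def)
  \<comment> \<open>The intermediate value may be found at 0, which is no position. Moving to 1
    keeps the count, as \<open>I\<close> has no element below 1.\<close>
  define k' where "k' = max 1 k"
  have "f k' = int t"
  proof (cases "k = 0")
    case True
    moreover have "{l\<in>I. l < 1} = {}" using assms(1) by auto
    ultimately show ?thesis using k by (simp add: k'_def f_def)
  qed (use k in \<open>simp add: k'_def max_def\<close>)
  moreover have "1 \<le> k'" "k' \<le> CARD('n)"
    using k by (auto simp: k'_def)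
  ultimately show ?thesis
    using that pos_surj[of k'] by (metis f_def level_def of_nat_eq_iff)
qed

lemma antimono_step_normal: "finite I \<Longrightarrow> antimono (\<lambda>i. step_normal I $ i)"
proof (rule antimonoI)
  fix i j :: 'a assume "finite I" "i \<le> j"
  then have "{l\<in>I. pos j \<le> l} \<subseteq> {l\<in>I. pos i \<le> l}"
    by (auto intro: order_trans[of "pos i" "pos j"])
  then show "step_normal I $ j \<le> step_normal I $ i"
    using \<open>finite I\<close> by (auto simp: step_normal_def intro!: card_mono)
qed

lemma step_normal_nonconstant:
  assumes "I \<subseteq> {1..<CARD('n::{finite,linorder})}" "I \<noteq> {}"
  shows "\<exists>i j. (step_normal I :: (real, 'n) vec) $ i \<noteq> (step_normal I :: (real, 'n) vec) $ j"
proof -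
  have fin: "finite I" using assms(1) finite_subset by blast
  then have "card I > 0" using assms(2) by (simp add: card_gt_0_iff)
  moreover obtain i j :: 'n where "level I i = 0" "level I j = card I"
    using level_hit[OF assms(1)] by (metis le0 order_refl)
  ultimately have "step_normal I $ i \<noteq> step_normal I $ j"
    using fin assms(2) by (simp add: step_normal_level)
  then show ?thesis by blast
qed

lemma corner_subset_step_halfspace_iff:
  assumes "M \<noteq> 0" "finite I"
  shows "corner_polyhedron M \<subseteq> {w. step_normal I \<bullet> w \<ge> c} \<longleftrightarrow>
    (\<forall>i j. M $ i $ j \<noteq> 0 \<longrightarrow> c \<le> real (level I j) - real (level I i))"
  unfolding corner_subset_halfspace_iff[OF assms(1)]
  by (simp add: antimono_step_normal[OF assms(2)]) (simp add: step_normal_level[OF assms(2)])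

text \<open>A missing link below level \<open>t\<close> lets the two sides of the cut move
  independently, which breaks rigidity. If all links are present, a compatible \<open>b\<close>
  changes by the same amount from each level to the next, so it is affine in the level. Labelling a
  link by its upper level through \<open>max\<close> treats both signs of \<open>c\<close> at
  once.\<close>

lemma step_facet_iff:
  fixes M :: "'k::field ^ 'n::{finite,linorder} ^ 'n::{finite,linorder}"
  assumes "M \<noteq> 0" and I: "I \<subseteq> {1..<CARD('n)}" "I \<noteq> {}" and c: "\<bar>c\<bar> = 1"
    and sub: "corner_polyhedron M \<subseteq> {w. step_normal I \<bullet> w \<ge> c}"
  shows "(corner_polyhedron M \<inter> {w. step_normal I \<bullet> w = c}) facet_of corner_polyhedron M \<longleftrightarrow>
    (\<forall>t\<in>{1..card I}. \<exists>i j. M $ i $ j \<noteq> 0 \<and> real (level I j) - real (level I i) = c \<and>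
        max (level I i) (level I j) = t)"
    (is "?facet \<longleftrightarrow> ?gaps")
proof -
  have fin: "finite I" using I(1) finite_subset by blast
  have card: "card I \<ge> 1" using fin I(2) by (simp add: Suc_le_eq card_gt_0_iff)
  note lv = step_normal_level[OF fin]
  note rigid = facet_iff_rigid[OF assms(1) sub step_normal_nonconstant[OF I]]
  show ?thesis
  proof
    assume ?facet
    note R = \<open>?facet\<close>[unfolded rigid]
    then obtain p q where pq: "M $ p $ q \<noteq> 0" "step_normal I $ p - step_normal I $ q = c"
      by blast
    have rig: "\<exists>l m. \<forall>i. b $ i = l * step_normal I $ i + m"
      if "\<And>i j. step_normal I $ i = step_normal I $ j \<Longrightarrow> b $ i = b $ j"
        "\<And>i j. M $ i $ j \<noteq> 0 \<Longrightarrow> step_normal I $ i - step_normal I $ j = c \<Longrightarrow> b $ i - b $ j = d" for b d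
      using conjunct2[OF R, rule_format, of b d] that by blast
    show ?gaps
    proof (rule ccontr)
      assume "\<not> ?gaps"
      then obtain t where t: "t \<in> {1..card I}"
        and no: "\<And>i j. M $ i $ j \<noteq> 0 \<Longrightarrow> real (level I j) - real (level I i) = c \<Longrightarrow>
            max (level I i) (level I j) \<noteq> t"
        by blast
      define b :: "(real, 'n) vec" where "b = (\<chi> i. of_bool (t \<le> level I i))"
      have "\<exists>l m. \<forall>i. b $ i = l * step_normal I $ i + m"
      proof (rule rig[of b 0])
        show "b $ i = b $ j" if "step_normal I $ i = step_normal I $ j" for i j
          using that by (simp add: b_def lv)
        \<comment> \<open>A tight entry joins adjacent levels. Its upper level is not
          \<open>t\<close>, so both lie on the same side of the cut.\<close>
        show "b $ i - b $ j = 0" if "M $ i $ j \<noteq> 0" "step_normal I $ i - step_normal I $ j = c" for i j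
        proof -
          have ij: "real (level I j) - real (level I i) = c" using that(2) by (simp add: lv)
          show ?thesis
            using no[OF that(1) ij] ij c by (auto simp: b_def of_bool_def abs_if max_def split: if_splits)
        qed
      qed
      then obtain l m where lm: "\<And>i. b $ i = l * step_normal I $ i + m" by blast
      have pq': "real (level I q) - real (level I p) = c" using pq(2) by (simp add: lv)
      \<comment> \<open>The normal differs by \<open>c \<noteq> 0\<close> on this tight entry while
        \<open>b\<close> does not, so the slope of \<open>b\<close> over the normal is 0.\<close>
      have "b $ p = b $ q"
        using no[OF pq(1) pq'] pq' c by (auto simp: b_def of_bool_def abs_if max_def split: if_splits)
      then have "l * c = 0" unfolding lm pq(2)[symmetric] by (simp add: algebra_simps)
      then have "l = 0" using c by auto
      moreover obtain i j :: 'n where "level I i = 0" "level I j = t"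
        using level_hit[OF I(1)] t by (metis le0 atLeastAtMost_iff)
      ultimately show False
        using lm[of i] lm[of j] t by (simp add: b_def)
    qed
  next
    assume gaps: ?gaps
    show ?facet
      unfolding rigid
    proof (intro conjI allI impI)
      show "\<exists>i j. M $ i $ j \<noteq> 0 \<and> step_normal I $ i - step_normal I $ j = c"
        using bspec[OF gaps, of 1] card by (auto simp: lv)
    next
      fix b :: "(real, 'n) vec" and d
      assume H: "(\<forall>i j. step_normal I $ i = step_normal I $ j \<longrightarrow> b $ i = b $ j) \<and>
            (\<forall>i j. M $ i $ j \<noteq> 0 \<and> step_normal I $ i - step_normal I $ j = c \<longrightarrow> b $ i - b $ j = d)"
      have level: "b $ i = b $ j" if "level I i = level I j" for i j
        using conjunct1[OF H, rule_format, of i j] that by (simp add: lv)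
      have tight: "b $ i - b $ j = d"
        if "M $ i $ j \<noteq> 0" "real (level I j) - real (level I i) = c" for i j
        using conjunct2[OF H, rule_format, of i j] that by (simp add: lv)
      obtain z :: 'n where z: "level I z = 0"
        using level_hit[OF I(1)] by (metis le0)
      \<comment> \<open>The tight row has the lower level for \<open>c = 1\<close> and the upper
        level for \<open>c = - 1\<close>. Hence \<open>b\<close> falls by \<open>d\<close> per level
        in the first case and rises by \<open>d\<close> in the second: by \<open>- c * d\<close> in
        both.\<close>
      have "b $ i = b $ z - c * d * real t" if "t \<le> card I" "level I i = t" for t i
        using that
      proof (induction t arbitrary: i)
        case 0
        then show ?case using level[of i z] z by simp
      next
        case (Suc t)
        then obtain p q where pq: "M $ p $ q \<noteq> 0" "real (level I q) - real (level I p) = c"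
            "max (level I p) (level I q) = Suc t"
          using gaps by (metis atLeastAtMost_iff le_add1 plus_1_eq_Suc)
        note diff = tight[OF pq(1,2)]
        show ?case
        proof (cases "c = 1")
          case True
          then have "level I q = Suc t" "level I p = t" using pq by auto
          then show ?thesis
            using Suc.IH[of p] Suc.prems level[of i q] diff True by (simp add: algebra_simps)
        next
          case False
          then have c: "c = - 1" using c by linarith
          then have "level I p = Suc t" "level I q = t" using pq by auto
          then show ?thesis
            using Suc.IH[of q] Suc.prems level[of i p] diff c by (simp add: algebra_simps)
        qed
      qed
      then have "b $ i = (c * d) * step_normal I $ i + (b $ z - c * d * real (card I))" for i
        using level_le[OF fin, of i] by (simp add: lv algebra_simps)
      then show "\<exists>l m. \<forall>i. b $ i = l * step_normal I $ i + m" by blast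
    qed
  qed
qed

text \<open>There are only two levels, so every \<open>b\<close> constant on levels is affine in the
  normal. Rigidity is automatic and only the existence of a tight entry remains.\<close>

lemma singleton_facet_iff:
  fixes M :: "'k::field ^ 'n::{finite,linorder} ^ 'n::{finite,linorder}"
  assumes "M \<noteq> 0" and I: "I \<subseteq> {1..<CARD('n)}" "card I = 1"
    and sub: "corner_polyhedron M \<subseteq> {w. step_normal I \<bullet> w \<ge> 0}"
  shows "(corner_polyhedron M \<inter> {w. step_normal I \<bullet> w = 0}) facet_of corner_polyhedron M \<longleftrightarrow>
    (\<exists>i j. M $ i $ j \<noteq> 0 \<and> level I i = level I j)"
proof -
  have fin: "finite I" using I(1) finite_subset by blast
  have "I \<noteq> {}" using I(2) by auto
  note lv = step_normal_level[OF fin]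
  note rigid = facet_iff_rigid[OF assms(1) sub step_normal_nonconstant[OF I(1) \<open>I \<noteq> {}\<close>]]
  have "\<exists>l m. \<forall>i. b $ i = l * step_normal I $ i + m"
    if "\<forall>i j. step_normal I $ i = step_normal I $ j \<longrightarrow> b $ i = b $ j" for b :: "(real, 'n) vec"
  proof -
    obtain y z :: 'n where yz: "level I y = 0" "level I z = 1"
      using level_hit[OF I(1)] I(2) by (metis le0 order_refl)
    have "b $ i = (b $ y - b $ z) * step_normal I $ i + b $ z" for i
    proof (cases "level I i = 0")
      case True
      then show ?thesis using that[rule_format, of i y] yz I(2) by (simp add: lv)
    next
      case False
      then have "level I i = 1" using level_le[OF fin, of i] I(2) by simp
      then show ?thesis using that[rule_format, of i z] yz I(2) by (simp add: lv)
    qed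
    then show ?thesis by blast
  qed
  moreover have "step_normal I $ i - step_normal I $ j = 0 \<longleftrightarrow> level I i = level I j" for i j :: 'n
    by (auto simp: lv)
  ultimately show ?thesis
    unfolding rigid by meson
qed

subsection \<open>Hessenberg functions\<close>

lemma mem_std_flag_iff:
  fixes x :: "'k::field ^ 'n::{finite,linorder}"
  shows "x \<in> std_flag \<rho> \<longleftrightarrow> (\<forall>i. pos i > \<rho> \<longrightarrow> x $ i = 0)"
proof
  have "vec.subspace {x :: ('k, 'n) vec. \<forall>i. pos i > \<rho> \<longrightarrow> x $ i = 0}"
    by (simp add: vec.subspace_def)
  then have "std_flag \<rho> \<subseteq> {x :: ('k, 'n) vec. \<forall>i. pos i > \<rho> \<longrightarrow> x $ i = 0}"
    unfolding std_flag_def by (intro vec.span_minimal) (auto simp: axis_def)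
  then show "\<forall>i. pos i > \<rho> \<longrightarrow> x $ i = 0" if "x \<in> std_flag \<rho>"
    using that by blast
next
  assume x: "\<forall>i. pos i > \<rho> \<longrightarrow> x $ i = 0"
  have "x $ i *s axis i 1 \<in> std_flag \<rho>" for i
  proof (cases "pos i \<le> \<rho>")
    case True
    then show ?thesis
      unfolding std_flag_def by (intro vec.span_scale vec.span_base) auto
  qed (use x in \<open>simp add: std_flag_def vec.span_zero\<close>)
  then have "(\<Sum>i\<in>UNIV. x $ i *s axis i 1) \<in> std_flag \<rho>"
    unfolding std_flag_def by (intro vec.span_sum) auto
  then show "x \<in> std_flag \<rho>"
    by (simp add: basis_expansion)
qed

lemma image_std_flag_subset_iff:
  fixes M :: "'k::field ^ 'n::{finite,linorder} ^ 'n::{finite,linorder}"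
  shows "(*v) M ` std_flag \<rho> \<subseteq> std_flag \<sigma> \<longleftrightarrow>
    (\<forall>i j. M $ i $ j \<noteq> 0 \<and> pos j \<le> \<rho> \<longrightarrow> pos i \<le> \<sigma>)"
proof
  assume sub: "(*v) M ` std_flag \<rho> \<subseteq> std_flag \<sigma>"
  show "\<forall>i j. M $ i $ j \<noteq> 0 \<and> pos j \<le> \<rho> \<longrightarrow> pos i \<le> \<sigma>"
  proof (intro allI impI, elim conjE)
    fix i j assume ij: "M $ i $ j \<noteq> 0" "pos j \<le> \<rho>"
    have "axis j 1 \<in> (std_flag \<rho> :: ('k, 'n) vec set)"
      using ij(2) by (auto simp: mem_std_flag_iff axis_def)
    then have "M *v axis j 1 \<in> std_flag \<sigma>" using sub by blast
    then have "pos i > \<sigma> \<longrightarrow> (M *v axis j 1) $ i = 0"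
      by (simp add: mem_std_flag_iff)
    moreover have "(M *v axis j 1) $ i = M $ i $ j"
      by (simp add: matrix_vector_mult_def axis_def if_distrib[of "\<lambda>x. _ * x"] cong: if_cong)
    ultimately show "pos i \<le> \<sigma>" using ij(1) by (metis not_le)
  qed
next
  assume M: "\<forall>i j. M $ i $ j \<noteq> 0 \<and> pos j \<le> \<rho> \<longrightarrow> pos i \<le> \<sigma>"
  show "(*v) M ` std_flag \<rho> \<subseteq> std_flag \<sigma>"
  proof (rule image_subsetI)
    fix x :: "('k, 'n) vec" assume x: "x \<in> std_flag \<rho>"
    have "M $ i $ j * x $ j = 0" if "pos i > \<sigma>" for i j
      using M x that unfolding mem_std_flag_iff by (metis mult_eq_0_iff not_le)
    then show "M *v x \<in> std_flag \<sigma>"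
      unfolding mem_std_flag_iff matrix_vector_mult_def by (auto intro!: sum.neutral)
  qed
qed

text \<open>The elements below \<open>x\<close> fill an initial segment of the sorted list. This
  turns the list access in \<open>subflag_index\<close> into a count comparable with
  \<open>level\<close>.\<close>

lemma nth_sorted_list_of_set_ge_iff:
  fixes A :: "'a::linorder set"
  assumes "finite A" "t < card A"
  shows "x \<le> sorted_list_of_set A ! t \<longleftrightarrow> card {a\<in>A. a < x} \<le> t"
proof -
  define xs where "xs = sorted_list_of_set A"
  have xs: "sorted_wrt (<) xs" "set xs = A" "length xs = card A" "distinct xs"
    using assms by (auto simp: xs_def)
  have mono: "xs ! s < xs ! u" if "s < u" "u < card A" for s u
    using sorted_wrt_nth_less[OF xs(1)] that xs(3) by simp
  have inj: "inj_on ((!) xs) {..<card A}"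
    using xs by (auto simp: inj_on_def nth_eq_iff_index_eq)
  show ?thesis
    unfolding xs_def[symmetric]
  proof
    assume le: "x \<le> xs ! t"
    have "{a\<in>A. a < x} \<subseteq> (!) xs ` {..<t}"
    proof
      fix a assume a: "a \<in> {a\<in>A. a < x}"
      then obtain s where s: "s < card A" "a = xs ! s"
        using xs by (metis (no_types, lifting) in_set_conv_nth mem_Collect_eq)
      have "s < t"
        using mono[of t s] s a le by (cases "s = t") (force simp: not_less_iff_gr_or_eq)+
      with s show "a \<in> (!) xs ` {..<t}" by auto
    qed
    then have "card {a\<in>A. a < x} \<le> card ((!) xs ` {..<t})"
      by (intro card_mono) auto
    also have "\<dots> \<le> t"
      using card_image_le[of "{..<t}" "(!) xs"] by simp
    finally show "card {a\<in>A. a < x} \<le> t" .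
  next
    assume card: "card {a\<in>A. a < x} \<le> t"
    show "x \<le> xs ! t"
    proof (rule ccontr)
      assume "\<not> x \<le> xs ! t"
      then have "xs ! s < x" if "s \<le> t" for s
        using mono[of s t] that assms(2) by (cases "s = t") auto
      then have "(!) xs ` {..t} \<subseteq> {a\<in>A. a < x}"
        using xs assms(2) by auto
      then have "card ((!) xs ` {..t}) \<le> card {a\<in>A. a < x}"
        using assms(1) by (intro card_mono) auto
      moreover have "card ((!) xs ` {..t}) = Suc t"
        using inj assms(2) by (subst card_image) (auto intro: inj_on_subset)
      ultimately show False using card by simp
    qed
  qed
qed

text \<open>Of the two added indices, 0 lies below every position and the last lies below none. The
  count is therefore \<open>Suc (level I i)\<close>, and the inequality for the level becomes
  strict.\<close>

lemma pos_le_subflag_index_iff: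
  fixes i :: "'n::{finite,linorder}"
  assumes "I \<subseteq> {1..<CARD('n)}" "t \<le> card I + 1"
  shows "pos i \<le> subflag_index CARD('n) I t \<longleftrightarrow> level I i < t"
proof -
  let ?A = "{0} \<union> I \<union> {CARD('n)}"
  have fin: "finite I" using assms(1) finite_subset by blast
  have "0 \<notin> I" "CARD('n) \<notin> I" using assms(1) by auto
  then have "card ?A = card I + 2" using fin by simp
  moreover have "{a\<in>?A. a < pos i} = insert 0 {l\<in>I. l < pos i}"
    using pos_le_card[of i] pos_ge_1[of i] by auto
  then have "card {a\<in>?A. a < pos i} = Suc (level I i)"
    unfolding level_def using fin \<open>0 \<notin> I\<close> by simp
  ultimately show ?thesis
    unfolding subflag_index_def using fin assms(2)
    by (subst nth_sorted_list_of_set_ge_iff) auto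
qed

lemma image_subflag_subset_iff:
  fixes M :: "'k::field ^ 'n::{finite,linorder} ^ 'n::{finite,linorder}"
  assumes "I \<subseteq> {1..<CARD('n)}" "t \<le> card I + 1" "t' \<le> card I + 1"
  shows "(*v) M ` subflag I t \<subseteq> subflag I t' \<longleftrightarrow>
    (\<forall>i j. M $ i $ j \<noteq> 0 \<and> level I j < t \<longrightarrow> level I i < t')"
  unfolding subflag_def image_std_flag_subset_iff
  using assms by (simp add: pos_le_subflag_index_iff)

text \<open>Minimality of \<open>s\<close> amounts to failure at \<open>s - 1\<close>, witnessed by
  an entry whose row has level at least \<open>s - 1\<close>. The form
  \<open>s \<le> level I i + 1\<close> avoids truncated subtraction.\<close>

lemma hessenberg_eq_iff:
  fixes M :: "'k::field ^ 'n::{finite,linorder} ^ 'n::{finite,linorder}"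
  assumes I: "I \<subseteq> {1..<CARD('n)}" and t: "t \<le> card I + 1" "s \<le> card I + 1"
  shows "hessenberg M I t = s \<longleftrightarrow>
    (\<forall>i j. M $ i $ j \<noteq> 0 \<and> level I j < t \<longrightarrow> level I i < s) \<and>
    (s = 0 \<or> (\<exists>i j. M $ i $ j \<noteq> 0 \<and> level I j < t \<and> s \<le> level I i + 1))"
proof -
  have fin: "finite I" using I finite_subset by blast
  let ?P = "\<lambda>s. s \<le> card I + 1 \<and> (\<forall>i j. M $ i $ j \<noteq> 0 \<and> level I j < t \<longrightarrow> level I i < s)"
  have eq: "hessenberg M I t = (LEAST s. ?P s)"
    unfolding hessenberg_def
    by (intro arg_cong[where f = Least] ext conj_cong refl image_subflag_subset_iff[OF I t(1)])
  \<comment> \<open>The last subflag is the whole space, so the minimum is taken over a nonempty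
    set.\<close>
  have "?P (card I + 1)"
    using level_le[OF fin] by (auto simp: less_Suc_eq_le)
  then have P: "?P (Least ?P)" by (rule LeastI)
  show ?thesis
  proof
    assume hs: "hessenberg M I t = s"
    have "\<not> ?P (s - 1)" if "s \<noteq> 0"
      using hs that not_less_Least[of "s - 1" ?P] unfolding eq by simp
    then show "(\<forall>i j. M $ i $ j \<noteq> 0 \<and> level I j < t \<longrightarrow> level I i < s) \<and>
        (s = 0 \<or> (\<exists>i j. M $ i $ j \<noteq> 0 \<and> level I j < t \<and> s \<le> level I i + 1))"
      using P hs t(2) unfolding eq by force
  next
    assume s: "(\<forall>i j. M $ i $ j \<noteq> 0 \<and> level I j < t \<longrightarrow> level I i < s) \<and>
        (s = 0 \<or> (\<exists>i j. M $ i $ j \<noteq> 0 \<and> level I j < t \<and> s \<le> level I i + 1))"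
    show "hessenberg M I t = s"
      unfolding eq
    proof (rule Least_equality)
      show "?P s" using s t(2) by blast
      show "s \<le> y" if "?P y" for y
        using s that by (metis Suc_eq_plus1 Suc_leI le_trans zero_le)
    qed
  qed
qed

text \<open>The upper bound at \<open>level I j + 1\<close> says that an entry raises the level by
  at most 1. Minimality at \<open>t\<close> gives an entry from below \<open>t\<close> to at least
  \<open>t\<close>, which must then go from \<open>t - 1\<close> to \<open>t\<close>.\<close>

lemma hessenberg_succ_iff:
  fixes M :: "'k::field ^ 'n::{finite,linorder} ^ 'n::{finite,linorder}"
  assumes I: "I \<subseteq> {1..<CARD('n)}"
  shows "(\<forall>t\<in>{1..card I}. hessenberg M I t = t + 1) \<longleftrightarrow>
    (\<forall>i j. M $ i $ j \<noteq> 0 \<longrightarrow> - 1 \<le> real (level I j) - real (level I i)) \<and>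
    (\<forall>t\<in>{1..card I}. \<exists>i j. M $ i $ j \<noteq> 0 \<and> real (level I j) - real (level I i) = - 1 \<and>
        max (level I i) (level I j) = t)"
    (is "?hess \<longleftrightarrow> ?edges \<and> ?gaps")
proof -
  have fin: "finite I" using I finite_subset by blast
  have h: "hessenberg M I t = t + 1 \<longleftrightarrow>
      (\<forall>i j. M $ i $ j \<noteq> 0 \<and> level I j < t \<longrightarrow> level I i \<le> t) \<and>
      (\<exists>i j. M $ i $ j \<noteq> 0 \<and> level I j < t \<and> t \<le> level I i)" if "t \<in> {1..card I}" for t
    using that by (subst hessenberg_eq_iff[OF I]) auto
  show ?thesis
  proof
    assume hess: ?hess
    have edges: "level I i \<le> level I j + 1" if "M $ i $ j \<noteq> 0" for i j
    proof (cases "level I j < card I")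
      case True
      then show ?thesis using hess h[of "level I j + 1"] that by auto
    next
      case False
      then show ?thesis using level_le[OF fin, of i] by simp
    qed
    moreover have "\<exists>i j. M $ i $ j \<noteq> 0 \<and> real (level I j) - real (level I i) = - 1 \<and>
        max (level I i) (level I j) = t" if t: "t \<in> {1..card I}" for t
    proof -
      obtain i j where ij: "M $ i $ j \<noteq> 0" "level I j < t" "t \<le> level I i"
        using h[OF t] hess t by blast
      with edges[OF ij(1)] have "level I j + 1 = level I i" "level I i = t" by auto
      with ij(1) show ?thesis by (intro exI[of _ i] exI[of _ j]) auto
    qed
    ultimately show "?edges \<and> ?gaps" by (fastforce simp: algebra_simps)
  next
    assume R: "?edges \<and> ?gaps"
    show ?hess
    proof
      fix t assume t: "t \<in> {1..card I}"
      have "level I i \<le> t" if "M $ i $ j \<noteq> 0" "level I j < t" for i j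
        using conjunct1[OF R, rule_format, OF that(1)] that(2) by linarith
      moreover obtain i j where ij: "M $ i $ j \<noteq> 0" "real (level I j) - real (level I i) = - 1"
          "max (level I i) (level I j) = t"
        using R t by blast
      then have "level I j < t" "t \<le> level I i" by auto
      ultimately show "hessenberg M I t = t + 1"
        unfolding h[OF t] using ij(1) by blast
    qed
  qed
qed

text \<open>The upper bound at \<open>level I j + 1\<close> says that an entry strictly lowers the
  level from column to row. Minimality then supplies entries that lower it by exactly 1.\<close>

lemma hessenberg_pred_iff:
  fixes M :: "'k::field ^ 'n::{finite,linorder} ^ 'n::{finite,linorder}"
  assumes I: "I \<subseteq> {1..<CARD('n)}"
  shows "(\<forall>t\<in>{1..card I + 1}. hessenberg M I t = t - 1) \<longleftrightarrow>
    (\<forall>i j. M $ i $ j \<noteq> 0 \<longrightarrow> 1 \<le> real (level I j) - real (level I i)) \<and>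
    (\<forall>t\<in>{1..card I}. \<exists>i j. M $ i $ j \<noteq> 0 \<and> real (level I j) - real (level I i) = 1 \<and>
        max (level I i) (level I j) = t)"
    (is "?hess \<longleftrightarrow> ?edges \<and> ?gaps")
proof -
  have fin: "finite I" using I finite_subset by blast
  have h: "hessenberg M I t = t - 1 \<longleftrightarrow>
      (\<forall>i j. M $ i $ j \<noteq> 0 \<and> level I j < t \<longrightarrow> level I i < t - 1) \<and>
      (t = 1 \<or> (\<exists>i j. M $ i $ j \<noteq> 0 \<and> level I j < t \<and> t - 1 \<le> level I i + 1))"
    if "t \<in> {1..card I + 1}" for t
    using that by (subst hessenberg_eq_iff[OF I]) auto
  show ?thesis
  proof
    assume hess: ?hess
    have edges: "level I i < level I j" if "M $ i $ j \<noteq> 0" for i j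
      using hess h[of "level I j + 1"] that level_le[OF fin, of j] by auto
    moreover have "\<exists>i j. M $ i $ j \<noteq> 0 \<and> real (level I j) - real (level I i) = 1 \<and>
        max (level I i) (level I j) = t" if t: "t \<in> {1..card I}" for t
    proof -
      \<comment> \<open>The link between levels \<open>t - 1\<close> and \<open>t\<close> comes from
        the value at \<open>t + 1\<close>. The value at 1 is 0, which is minimal without a
        witness.\<close>
      have t': "t + 1 \<in> {1..card I + 1}" using t by simp
      obtain i j where ij: "M $ i $ j \<noteq> 0" "level I j < t + 1" "t \<le> level I i + 1"
        using h[OF t'] bspec[OF hess t'] t by auto
      with edges[OF ij(1)] have "level I j = level I i + 1" "level I j = t" by auto
      with ij(1) show ?thesis by (intro exI[of _ i] exI[of _ j]) auto
    qed
    ultimately show "?edges \<and> ?gaps" by (fastforce simp: algebra_simps)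
  next
    assume R: "?edges \<and> ?gaps"
    show ?hess
    proof
      fix t assume t: "t \<in> {1..card I + 1}"
      have "level I i < t - 1" if "M $ i $ j \<noteq> 0" "level I j < t" for i j
        using conjunct1[OF R, rule_format, OF that(1)] that(2) by linarith
      moreover have "\<exists>i j. M $ i $ j \<noteq> 0 \<and> level I j < t \<and> t - 1 \<le> level I i + 1" if "t \<noteq> 1"
      proof -
        have "t - 1 \<in> {1..card I}" using t that by auto
        then obtain i j where ij: "M $ i $ j \<noteq> 0" "real (level I j) - real (level I i) = 1"
            "max (level I i) (level I j) = t - 1"
          using R by blast
        then have "level I j < t" "t - 1 \<le> level I i + 1" using t by auto
        with ij(1) show ?thesis by blast
      qed
      ultimately show "hessenberg M I t = t - 1"
        unfolding h[OF t] by blast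
    qed
  qed
qed

subsection \<open>Classification of facets\<close>

lemma nonconstant_iff_Wbar:
  fixes a :: "real ^ 'n::{finite,linorder}"
  shows "(\<exists>w\<in>Wbar. a \<bullet> w \<noteq> 0) \<longleftrightarrow> (\<exists>i j. a $ i \<noteq> a $ j)"
proof
  assume "\<exists>i j. a $ i \<noteq> a $ j"
  then obtain i j where "a $ i \<noteq> a $ j" by blast
  then have "a \<bullet> (axis i 1 - axis j 1) \<noteq> 0" by (simp only: inner_root right_minus_eq not_False_eq_True)
  then show "\<exists>w\<in>Wbar. a \<bullet> w \<noteq> 0" using root_in_Wbar by blast
next
  assume "\<exists>w\<in>Wbar. a \<bullet> w \<noteq> 0"
  then obtain w where w: "w \<in> Wbar" "a \<bullet> w \<noteq> 0" by blast
  show "\<exists>i j. a $ i \<noteq> a $ j"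
  proof (rule ccontr)
    assume "\<not> ?thesis"
    then obtain m where "\<And>i. a $ i = m" by metis
    then have "a \<bullet> w = m * (\<Sum>i\<in>UNIV. w $ i)"
      by (simp add: inner_vec_def sum_distrib_left)
    with w show False by (simp add: Wbar_def)
  qed
qed

lemma s_halfspace_eq: "finite I \<Longrightarrow> s_halfspace I c = {w \<in> Wbar. step_normal I \<bullet> w \<ge> c}"
  by (simp add: s_halfspace_def s_sum_inner)

text \<open>At a boundary point of the first description that is interior for the second, a short
  move inside \<open>Wbar\<close> that decreases \<open>a\<close> would leave the first halfspace
  but not the second. So the set determines its bounding hyperplane.\<close>

lemma Wbar_halfspace_boundary_subset:
  fixes a b :: "real ^ 'n::{finite,linorder}"
  assumes "{w \<in> Wbar. a \<bullet> w \<ge> c} = {w \<in> Wbar. b \<bullet> w \<ge> d}" "\<exists>w\<in>Wbar. a \<bullet> w \<noteq> 0"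
    and w: "w \<in> Wbar" "a \<bullet> w = c"
  shows "b \<bullet> w = d"
proof (rule ccontr)
  have bw: "b \<bullet> w \<ge> d" using assms(1) w by blast
  assume "b \<bullet> w \<noteq> d"
  with bw have gt: "b \<bullet> w > d" by simp
  from assms(2) obtain z' where "z' \<in> Wbar" "a \<bullet> z' \<noteq> 0" by blast
  \<comment> \<open>Scaling by the negated value makes the value of \<open>a\<close> minus a nonzero
    square.\<close>
  then have "(- (a \<bullet> z')) *\<^sub>R z' \<in> Wbar" "a \<bullet> ((- (a \<bullet> z')) *\<^sub>R z') < 0"
    by (blast intro: subspace_mul[OF subspace_Wbar])
      (use \<open>a \<bullet> z' \<noteq> 0\<close> in \<open>simp add: not_le flip: power2_eq_square\<close>)
  then obtain z where z: "z \<in> Wbar" "a \<bullet> z < 0" by blast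
  \<comment> \<open>Short enough that \<open>b\<close> changes by at most its slack at
    \<open>w\<close>; the added 1 keeps the denominator positive.\<close>
  define t where "t = (b \<bullet> w - d) / (\<bar>b \<bullet> z\<bar> + 1)"
  have t: "t > 0" using gt by (simp add: t_def)
  have "t * \<bar>b \<bullet> z\<bar> \<le> t * (\<bar>b \<bullet> z\<bar> + 1)" using t by simp
  also have "\<dots> = b \<bullet> w - d" by (simp add: t_def)
  finally have "\<bar>t * (b \<bullet> z)\<bar> \<le> b \<bullet> w - d" using t by (simp add: abs_mult)
  then have "b \<bullet> (w + t *\<^sub>R z) \<ge> d" by (simp add: inner_add_right)
  moreover have "w + t *\<^sub>R z \<in> Wbar"
    using w(1) z(1) by (intro subspace_add subspace_mul subspace_Wbar)
  ultimately have "a \<bullet> (w + t *\<^sub>R z) \<ge> c" using assms(1) by blast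
  then have "0 \<le> t * (a \<bullet> z)" using w(2) by (simp add: inner_add_right)
  then show False using t z(2) by (simp add: zero_le_mult_iff)
qed

text \<open>A supporting halfspace may be represented by any normal, but all representations share
  the boundary in \<open>Wbar\<close>, so the face can be computed with
  \<open>step_normal I\<close>.\<close>

lemma supporting_s_halfspace_iff:
  fixes P :: "(real ^ 'n::{finite,linorder}) set"
  assumes I: "I \<subseteq> {1..<CARD('n)}" "I \<noteq> {}" and P: "P \<subseteq> Wbar"
  shows "supporting_halfspace P F (s_halfspace I c) \<longleftrightarrow>
    P \<subseteq> {w. step_normal I \<bullet> w \<ge> c} \<and> F = P \<inter> {w. step_normal I \<bullet> w = c}"
proof -
  have fin: "finite I" using I(1) finite_subset by blast
  note nc = step_normal_nonconstant[OF I, folded nonconstant_iff_Wbar]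
  show ?thesis
  proof
    assume "supporting_halfspace P F (s_halfspace I c)"
    then obtain a d where a: "\<exists>w\<in>Wbar. a \<bullet> w \<noteq> 0" "s_halfspace I c = {w \<in> Wbar. a \<bullet> w \<ge> d}"
        "P \<subseteq> s_halfspace I c" "F = P \<inter> {w. a \<bullet> w = d}"
      unfolding supporting_halfspace_def by blast
    have eq: "{w \<in> Wbar. step_normal I \<bullet> w \<ge> c} = {w \<in> Wbar. a \<bullet> w \<ge> d}"
      using a(2) by (simp add: s_halfspace_eq[OF fin])
    have "step_normal I \<bullet> w = c \<longleftrightarrow> a \<bullet> w = d" if "w \<in> Wbar" for w
    proof
      show "a \<bullet> w = d" if "step_normal I \<bullet> w = c"
        by (rule Wbar_halfspace_boundary_subset[OF eq nc \<open>w \<in> Wbar\<close> that])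
      show "step_normal I \<bullet> w = c" if "a \<bullet> w = d"
        by (rule Wbar_halfspace_boundary_subset[OF eq[symmetric] a(1) \<open>w \<in> Wbar\<close> that])
    qed
    then have "P \<inter> {w. a \<bullet> w = d} = P \<inter> {w. step_normal I \<bullet> w = c}"
      using P by blast
    moreover have "P \<subseteq> {w. step_normal I \<bullet> w \<ge> c}"
      using a(3) unfolding s_halfspace_eq[OF fin] by blast
    ultimately show "P \<subseteq> {w. step_normal I \<bullet> w \<ge> c} \<and> F = P \<inter> {w. step_normal I \<bullet> w = c}"
      using a(4) by simp
  next
    assume R: "P \<subseteq> {w. step_normal I \<bullet> w \<ge> c} \<and> F = P \<inter> {w. step_normal I \<bullet> w = c}"
    show "supporting_halfspace P F (s_halfspace I c)"
      unfolding supporting_halfspace_def s_halfspace_eq[OF fin]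
      by (intro exI[of _ "step_normal I"] exI[of _ c] conjI nc refl) (use R P in auto)
  qed
qed

text \<open>If the face cut out is nonempty, the constant is the minimum of \<open>s_sum I\<close>
  on \<open>P\<close>. Hence both constants agree.\<close>

lemma supported_facet_unique:
  fixes P :: "(real ^ 'n::{finite,linorder}) set"
  assumes I: "I \<subseteq> {1..<CARD('n)}" "I \<noteq> {}" and P: "P \<subseteq> Wbar"
    and F: "F \<noteq> {}" "supporting_halfspace P F (s_halfspace I c)"
    and F': "F' \<noteq> {}" "supporting_halfspace P F' (s_halfspace I c')"
  shows "F = F'"
proof -
  note sup = F(2)[unfolded supporting_s_halfspace_iff[OF I P]] F'(2)[unfolded supporting_s_halfspace_iff[OF I P]]
  have "c = c'"
    using sup F(1) F'(1) by fastforce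
  then show ?thesis using sup by simp
qed

section \<open>Normal forms of facet normals\<close>

lemma inner_rescaled_on_Wbar:
  fixes a :: "real ^ 'n::{finite,linorder}"
  assumes "s > 0" and e: "\<And>i. e $ i = s * (a $ i - m)" and w: "w \<in> Wbar"
  shows "e \<bullet> w = s * (a \<bullet> w)"
proof -
  have "e = s *\<^sub>R (a - m *\<^sub>R 1)"
    using e by (simp add: vec_eq_iff)
  then show ?thesis using w by (simp add: inner_diff_left Wbar_eq_inner)
qed

text \<open>The set \<open>I\<close> records where \<open>f\<close> drops. Since \<open>f\<close> is
  nonincreasing, \<open>g p\<close> is the position of the last index with value at least
  \<open>p\<close>, for \<open>p\<close> from 1 to \<open>K\<close>. As every value is attained,
  these positions are distinct.\<close>

lemma step_normal_of_levels:
  fixes f :: "'n::{finite,linorder} \<Rightarrow> nat"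
  assumes anti: "\<And>i j. i \<le> j \<Longrightarrow> f j \<le> f i" and range: "range f = {0..K}"
  obtains I where "I \<subseteq> {1..<CARD('n)}" "card I = K" "step_normal I = (\<chi> i. real (f i))"
proof -
  define g where "g p = card {j. p \<le> f j}" for p
  have pos_le: "pos i \<le> g p \<longleftrightarrow> p \<le> f i" for i p
  proof
    assume "p \<le> f i"
    then have "{j. j \<le> i} \<subseteq> {j. p \<le> f j}" using anti order_trans by blast
    then show "pos i \<le> g p" unfolding pos_def g_def by (intro card_mono) auto
  next
    assume le: "pos i \<le> g p"
    show "p \<le> f i"
    proof (rule ccontr)
      assume n: "\<not> p \<le> f i"
      then have "{j. p \<le> f j} \<subseteq> {j. j \<le> i} - {i}"
        using anti by (auto simp: not_le) (metis le_cases le_trans not_le)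
      then have "{j. p \<le> f j} \<subset> {j. j \<le> i}" by blast
      then have "g p < pos i" unfolding pos_def g_def by (intro psubset_card_mono) auto
      with le show False by simp
    qed
  qed
  have inj: "inj_on g {1..K}"
  proof (rule inj_onI)
    fix p q assume p: "p \<in> {1..K}" "q \<in> {1..K}" "g p = g q"
    then have "p \<in> range f" "q \<in> range f" using range by auto
    then obtain i j where "f i = p" "f j = q" by blast
    then show "p = q"
      using pos_le[of i p] pos_le[of i q] pos_le[of j p] pos_le[of j q] p(3) by simp
  qed
  let ?I = "g ` {1..K}"
  have "g p \<in> {1..<CARD('n)}" if "p \<in> {1..K}" for p
  proof -
    have "p \<in> range f" "0 \<in> range f" using that range by auto
    then obtain i z where "f i = p" "f z = 0" by (metis rangeE)
    then have "1 \<le> g p" using pos_le[of i p] pos_ge_1[of i] by simp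
    \<comment> \<open>The attained value 0 keeps the last position out of \<open>I\<close>.\<close>
    moreover have "g p < pos z" using pos_le[of z p] \<open>f z = 0\<close> that by simp
    ultimately show ?thesis using pos_le_card[of z] by simp
  qed
  moreover have "card ?I = K" using card_image[OF inj] by simp
  moreover have "card {l\<in>?I. pos i \<le> l} = f i" for i
  proof -
    have "f i \<le> K" using range by (metis atLeastAtMost_iff rangeI)
    then have "{l\<in>?I. pos i \<le> l} = g ` {1..f i}"
      using pos_le by fastforce
    moreover have "inj_on g {1..f i}"
      using inj \<open>f i \<le> K\<close> by (auto intro: inj_on_subset)
    ultimately show ?thesis by (simp add: card_image)
  qed
  ultimately show ?thesis
    using that[of ?I] by (simp add: step_normal_def image_subset_iff)
qed

text \<open>Indicator vectors unchanged across differences of size \<open>c\<close> are admissible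
  with \<open>d = 0\<close>, and rigidity forces them to be constant. Two such tests make the
  coordinates integers without gaps, which \<open>step_normal_of_levels\<close> encodes by a
  set.\<close>

lemma facet_step_form:
  fixes M :: "'k::field ^ 'n::{finite,linorder} ^ 'n::{finite,linorder}"
  assumes "M \<noteq> 0" and sub: "corner_polyhedron M \<subseteq> {w. a \<bullet> w \<ge> c}"
    and noncst: "\<exists>i j. a $ i \<noteq> a $ j"
    and facet: "(corner_polyhedron M \<inter> {w. a \<bullet> w = c}) facet_of corner_polyhedron M"
    and c: "\<bar>c\<bar> = 1" and last: "a $ Max UNIV = 0"
  obtains I where "I \<subseteq> {1..<CARD('n)}" "I \<noteq> {}" "a = step_normal I"
proof -
  have anti: "a $ j \<le> a $ i" if "i \<le> j" for i j
    using sub that unfolding corner_subset_halfspace_iff[OF \<open>M \<noteq> 0\<close>] by (blast dest: antimonoD)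
  have nonneg: "0 \<le> a $ i" for i
    using anti[of i "Max UNIV"] last by simp
  note R = facet[unfolded facet_iff_rigid[OF \<open>M \<noteq> 0\<close> sub noncst]]
  obtain p q where pq: "M $ p $ q \<noteq> 0" "a $ p - a $ q = c" using R by blast
  \<comment> \<open>Rigidity with \<open>d = 0\<close>: an affine function of \<open>a\<close> that
    agrees at \<open>p\<close> and \<open>q\<close>, where \<open>a\<close> differs by
    \<open>c \<noteq> 0\<close>, is constant.\<close>
  have rigid: "b $ i = b $ j"
    if "\<And>i j. a $ i = a $ j \<Longrightarrow> b $ i = b $ j" "\<And>i j. a $ i - a $ j = c \<Longrightarrow> b $ i = b $ j"
    for b :: "(real, 'n) vec" and i j
  proof -
    have "\<exists>l m. \<forall>i. b $ i = l * a $ i + m"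
    proof (rule conjunct2[OF R, rule_format], intro conjI allI impI, goal_cases)
      case (1 i j)
      then show ?case by (rule that(1))
    next
      case (2 i j)
      then show "b $ i - b $ j = 0" using that(2)[of i j] by simp
    qed
    then obtain l m where lm: "\<And>i. b $ i = l * a $ i + m" by blast
    have "b $ p = b $ q" by (rule that(2)[OF pq(2)])
    then have "l * c = 0" unfolding lm pq(2)[symmetric] by (simp add: algebra_simps)
    then have "l = 0" using c by auto
    then show ?thesis by (simp add: lm)
  qed
  have int: "a $ i \<in> \<int>" for i
  proof -
    \<comment> \<open>Tight entries have \<open>a\<close>-difference \<open>\<plusminus>1\<close>, so shifting the non-integral coordinates preserves them.\<close>
    define b :: "(real, 'n) vec" where "b = (\<chi> i. of_bool (a $ i \<in> \<int>))"
    have "b $ i = b $ Max UNIV"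
    proof (rule rigid)
      show "b $ i = b $ j" if "a $ i = a $ j" for i j using that by (simp add: b_def)
      show "b $ i = b $ j" if "a $ i - a $ j = c" for i j
      proof -
        have "c \<in> \<int>" using c by (auto simp: abs_if split: if_splits)
        moreover have "a $ i = a $ j + c" "a $ j = a $ i - c" using that by simp_all
        ultimately have "a $ i \<in> \<int> \<longleftrightarrow> a $ j \<in> \<int>" by (metis Ints_add Ints_diff)
        then show ?thesis by (simp add: b_def)
      qed
    qed
    then show ?thesis by (simp add: b_def last split: if_splits)
  qed
  define f where "f i = nat \<lfloor>a $ i\<rfloor>" for i
  have f: "a $ i = real (f i)" for i
    using int[of i] nonneg[of i] by (auto simp: f_def elim!: Ints_cases)
  have "range f = {0..f (Min UNIV)}"
  proof
    show "range f \<subseteq> {0..f (Min UNIV)}"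
      using anti[of "Min UNIV"] by (auto simp: f)
    show "{0..f (Min UNIV)} \<subseteq> range f"
    proof
      fix t assume t: "t \<in> {0..f (Min UNIV)}"
      show "t \<in> range f"
      proof (rule ccontr)
        assume no: "t \<notin> range f"
        then have neq: "f i \<noteq> t" for i by blast
        \<comment> \<open>A difference of size 1 cannot jump over the missed value \<open>t\<close>,
          so cutting the coordinates there is compatible with tight entries.\<close>
        define b :: "(real, 'n) vec" where "b = (\<chi> i. of_bool (t \<le> f i))"
        have "b $ Min UNIV = b $ Max UNIV"
        proof (rule rigid)
          show "b $ i = b $ j" if "a $ i = a $ j" for i j using that by (simp add: b_def f)
          show "b $ i = b $ j" if "a $ i - a $ j = c" for i j
          proof -
            have "f i \<le> f j + 1" "f j \<le> f i + 1" using that c by (auto simp: f)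
            then show ?thesis using neq[of i] neq[of j] by (auto simp: b_def)
          qed
        qed
        moreover have "f (Max UNIV) = 0" using last by (simp add: f)
        ultimately show False using t neq[of "Max UNIV"] by (simp add: b_def)
      qed
    qed
  qed
  moreover have "f j \<le> f i" if "i \<le> j" for i j
    using anti[OF that] by (simp add: f)
  ultimately obtain I where I: "I \<subseteq> {1..<CARD('n)}" "step_normal I = (\<chi> i. real (f i))"
    using step_normal_of_levels[of f "f (Min UNIV)"] by metis
  then have a: "a = step_normal I" by (simp add: vec_eq_iff f)
  moreover have "I \<noteq> {}"
    using noncst unfolding a by (auto simp: step_normal_def)
  ultimately show ?thesis using that I(1) by blast
qed

text \<open>For \<open>c = 0\<close> tight entries join equal coordinates, so the superlevel
  indicator at \<open>a $ k\<close> is admissible with \<open>d = 0\<close> and affine in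
  \<open>a\<close>. It is 1 both at the first index and at \<open>k\<close>; hence
  \<open>a $ k = 1\<close>, or the indicator is constantly 1 and \<open>a $ k\<close> is the minimum
  0.\<close>

lemma facet_through_cone_form:
  fixes M :: "'k::field ^ 'n::{finite,linorder} ^ 'n::{finite,linorder}"
  assumes "M \<noteq> 0" and sub: "corner_polyhedron M \<subseteq> {w. a \<bullet> w \<ge> 0}"
    and noncst: "\<exists>i j. a $ i \<noteq> a $ j"
    and facet: "(corner_polyhedron M \<inter> {w. a \<bullet> w = 0}) facet_of corner_polyhedron M"
    and first: "a $ Min UNIV = 1" and last: "a $ Max UNIV = 0"
  obtains I where "I \<subseteq> {1..<CARD('n)}" "card I = 1" "a = step_normal I"
proof -
  have anti: "a $ j \<le> a $ i" if "i \<le> j" for i j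
    using sub that unfolding corner_subset_halfspace_iff[OF \<open>M \<noteq> 0\<close>] by (blast dest: antimonoD)
  note R = facet[unfolded facet_iff_rigid[OF \<open>M \<noteq> 0\<close> sub noncst]]
  have zero_one: "a $ k = 0 \<or> a $ k = 1" for k
  proof -
    define b :: "(real, 'n) vec" where "b = (\<chi> i. of_bool (a $ k \<le> a $ i))"
    have "\<exists>l m. \<forall>i. b $ i = l * a $ i + m"
      using conjunct2[OF R, rule_format, of b 0] by (auto simp: b_def)
    then obtain l m where lm: "\<And>i. b $ i = l * a $ i + m" by blast
    have "b $ Min UNIV = 1" using anti[of "Min UNIV" k] by (simp add: b_def)
    then have "l + m = 1" "l * a $ k + m = 1"
      using lm[of "Min UNIV"] lm[of k] first by (simp_all add: b_def)
    then have "l * (1 - a $ k) = 0" by (simp only: right_diff_distrib)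
    moreover have "a $ k = 0" if "l = 0"
      using lm[of "Min UNIV"] lm[of "Max UNIV"] \<open>b $ Min UNIV = 1\<close> that anti[of k "Max UNIV"] last
      by (simp add: b_def split: if_splits)
    ultimately show ?thesis by auto
  qed
  define f :: "'n \<Rightarrow> nat" where "f i = (if a $ i = 0 then 0 else 1)" for i
  have f: "a $ i = real (f i)" for i using zero_one[of i] by (auto simp: f_def)
  have "f (Min UNIV) = 1" "f (Max UNIV) = 0" using first last by (simp_all add: f_def)
  then have "range f = {0..1}"
    by (auto simp: f_def image_iff) (metis (full_types) le_Suc_eq le_zero_eq One_nat_def)+
  moreover have "f j \<le> f i" if "i \<le> j" for i j
    using anti[OF that] by (simp add: f)
  ultimately obtain I where I: "I \<subseteq> {1..<CARD('n)}" "card I = 1" "step_normal I = (\<chi> i. real (f i))"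
    using step_normal_of_levels[of f 1] by metis
  then show ?thesis using that[of I] by (simp add: vec_eq_iff f)
qed

text \<open>A normal may be shifted by a constant and scaled by a positive factor. The shift makes
  the last coordinate 0; the scale makes the bound \<open>\<plusminus>1\<close>, or the first
  coordinate 1 if the bound is 0.\<close>

lemma facet_normal_form:
  fixes M :: "'k::field ^ 'n::{finite,linorder} ^ 'n::{finite,linorder}"
  assumes "M \<noteq> 0" and facet: "F facet_of corner_polyhedron M"
    and supp: "supporting_halfspace (corner_polyhedron M) F H"
  obtains I c where "I \<subseteq> {1..<CARD('n)}" "I \<noteq> {}" "H = s_halfspace I c"
    "\<bar>c\<bar> = 1 \<or> c = 0 \<and> card I = 1"
proof -
  let ?P = "corner_polyhedron M"
  obtain a c where a: "\<exists>w\<in>Wbar. a \<bullet> w \<noteq> 0" "H = {w \<in> Wbar. a \<bullet> w \<ge> c}"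
      "?P \<subseteq> H" "F = ?P \<inter> {w. a \<bullet> w = c}"
    using supp unfolding supporting_halfspace_def by blast
  have anti: "a $ j \<le> a $ i" if "i \<le> j" for i j
    using a(2,3) that corner_subset_halfspace_iff[OF \<open>M \<noteq> 0\<close>, where a = a and c = c] by (blast dest: antimonoD)
  define s where "s = (if c = 0 then 1 / (a $ Min UNIV - a $ Max UNIV) else 1 / \<bar>c\<bar>)"
  define e :: "(real, 'n) vec" where "e = (\<chi> i. s * (a $ i - a $ Max UNIV))"
  have "a $ Max UNIV < a $ Min UNIV"
  proof (rule ccontr)
    assume n: "\<not> ?thesis"
    have "a $ i = a $ Max UNIV" for i
      using n anti[of "Min UNIV" i] anti[of i "Max UNIV"] by simp
    then show False using a(1)[unfolded nonconstant_iff_Wbar] by metis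
  qed
  then have s: "s > 0" by (simp add: s_def)
  have e: "e \<bullet> w = s * (a \<bullet> w)" if "w \<in> Wbar" for w
    using s that by (intro inner_rescaled_on_Wbar) (auto simp: e_def)
  have H: "H = {w \<in> Wbar. e \<bullet> w \<ge> s * c}"
    using s unfolding a(2) by (auto simp: e)
  have F: "F = ?P \<inter> {w. e \<bullet> w = s * c}"
    using s corner_subset_Wbar[of M] unfolding a(4) by (auto simp: e)
  have sub: "?P \<subseteq> {w. e \<bullet> w \<ge> s * c}"
    using a(3) unfolding H by blast
  have nc: "\<exists>i j. e $ i \<noteq> e $ j"
    using a(1) s e unfolding nonconstant_iff_Wbar[symmetric] by auto
  have last: "e $ Max UNIV = 0" by (simp add: e_def)
  show ?thesis
  proof (cases "c = 0")
    case True
    have "e $ Min UNIV = 1"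
      using True \<open>a $ Max UNIV < a $ Min UNIV\<close> by (simp add: e_def s_def)
    then obtain I where I: "I \<subseteq> {1..<CARD('n)}" "card I = 1" "e = step_normal I"
      using facet_through_cone_form[OF \<open>M \<noteq> 0\<close> _ nc _ _ last] sub facet True unfolding F by auto
    have "finite I" using I(1) finite_subset by blast
    then have "H = s_halfspace I 0"
      unfolding H I(3) by (simp add: s_halfspace_eq True)
    then show ?thesis using I by (intro that[of I 0]) auto
  next
    case False
    then have c: "\<bar>s * c\<bar> = 1" by (simp add: s_def abs_mult)
    obtain I where I: "I \<subseteq> {1..<CARD('n)}" "I \<noteq> {}" "e = step_normal I"
      using facet_step_form[OF \<open>M \<noteq> 0\<close> sub nc facet[unfolded F] c last] by blast
    have "finite I" using I(1) finite_subset by blast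
    then have "H = s_halfspace I (s * c)"
      unfolding H I(3) by (simp add: s_halfspace_eq)
    then show ?thesis using I c by (intro that[of I "s * c"]) auto
  qed
qed

text \<open>A hyperplane supporting the polyhedron at a relative interior point of \<open>F\<close>
  cuts out a proper face containing \<open>F\<close>. As \<open>F\<close> has codimension 1, the two
  coincide.\<close>

lemma facet_supporting_halfspace_exists:
  fixes M :: "'k::field ^ 'n::{finite,linorder} ^ 'n::{finite,linorder}"
  assumes "F facet_of corner_polyhedron M"
  shows "\<exists>H. supporting_halfspace (corner_polyhedron M) F H"
proof -
  let ?P = "corner_polyhedron M"
  have face: "F face_of ?P" "F \<noteq> {}" and dim: "aff_dim F = aff_dim ?P - 1"
    using assms by (auto simp: facet_of_def)
  then have "F \<noteq> ?P" by auto
  obtain x where x: "x \<in> rel_interior F"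
    using face_of_imp_convex[OF face(1)] face(2) rel_interior_eq_empty by blast
  then have "x \<in> F" using rel_interior_subset by blast
  then have xP: "x \<in> ?P" using face_of_imp_subset[OF face(1)] by blast
  have "x \<notin> rel_interior ?P"
    using face_of_disjoint_rel_interior[OF face(1) \<open>F \<noteq> ?P\<close>] \<open>x \<in> F\<close> by blast
  then obtain a where a: "\<And>y. y \<in> ?P \<Longrightarrow> a \<bullet> x \<le> a \<bullet> y"
      "\<And>y. y \<in> rel_interior ?P \<Longrightarrow> a \<bullet> x < a \<bullet> y"
    using supporting_hyperplane_rel_boundary[OF convex_corner xP] by metis
  let ?G = "?P \<inter> {y. a \<bullet> y = a \<bullet> x}"
  have G: "?G face_of ?P"
    using a(1) by (intro face_of_Int_supporting_hyperplane_ge convex_corner)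
  obtain y where y: "y \<in> rel_interior ?P"
    using rel_interior_eq_empty[OF convex_corner] xP by blast
  then have yP: "y \<in> ?P" using rel_interior_subset by blast
  \<comment> \<open>A face that meets the relative interior of \<open>F\<close> contains all of
    \<open>F\<close>.\<close>
  have "F \<subseteq> ?G"
    by (rule subset_of_face_of[OF G face_of_imp_subset[OF face(1)]]) (use x xP in auto)
  moreover have "?G \<noteq> ?P" using a(2)[OF y] yP by force
  ultimately have "F face_of ?G" "aff_dim ?G < aff_dim ?P"
    using face_of_subset[OF face(1) _ face_of_imp_subset[OF G]] face_of_aff_dim_lt[OF convex_corner G]
    by auto
  then have "F = ?G"
    using dim face_of_aff_dim_lt[OF face_of_imp_convex[OF G], of F] by force
  moreover have "y - x \<in> Wbar" "a \<bullet> (y - x) \<noteq> 0"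
    using xP yP corner_subset_Wbar a(2)[OF y]
    by (auto intro!: subspace_diff[OF subspace_Wbar] simp: inner_diff_right)
  ultimately have "supporting_halfspace ?P F {w \<in> Wbar. a \<bullet> w \<ge> a \<bullet> x}"
    unfolding supporting_halfspace_def using a(1) corner_subset_Wbar
    by (intro exI[of _ a] exI[of _ "a \<bullet> x"]) blast
  then show ?thesis by blast
qed

text \<open>The annihilator of a facet is spanned by its normal and \<open>1\<close>, so on
  \<open>Wbar\<close> a second normal is a multiple of the first.\<close>

lemma facet_supporting_halfspace_unique:
  fixes M :: "'k::field ^ 'n::{finite,linorder} ^ 'n::{finite,linorder}"
  assumes "M \<noteq> 0" and facet: "F facet_of corner_polyhedron M"
    and supp: "supporting_halfspace (corner_polyhedron M) F H" "supporting_halfspace (corner_polyhedron M) F H'"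
  shows "H = H'"
proof -
  let ?P = "corner_polyhedron M"
  obtain a c where a: "\<exists>w\<in>Wbar. a \<bullet> w \<noteq> 0" "H = {w \<in> Wbar. a \<bullet> w \<ge> c}"
      "?P \<subseteq> H" "F = ?P \<inter> {w. a \<bullet> w = c}"
    using supp(1) unfolding supporting_halfspace_def by blast
  obtain a' c' where a': "\<exists>w\<in>Wbar. a' \<bullet> w \<noteq> 0" "H' = {w \<in> Wbar. a' \<bullet> w \<ge> c'}"
      "?P \<subseteq> H'" "F = ?P \<inter> {w. a' \<bullet> w = c'}"
    using supp(2) unfolding supporting_halfspace_def by blast
  have sub: "?P \<subseteq> {w. a \<bullet> w \<ge> c}" using a(2,3) by blast
  have ann: "affine_annihilator F = span {a, 1}"
    using facet facet_iff_annihilator[OF \<open>M \<noteq> 0\<close> sub a(1)[unfolded nonconstant_iff_Wbar]]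
    unfolding a(4) by blast
  have "a' \<in> affine_annihilator F"
    unfolding affine_annihilator_def a'(4) by blast
  then obtain l m where lm: "\<And>i. a' $ i = l * a $ i + m"
    unfolding ann span_one_insert by blast
  have "a' = l *\<^sub>R a + m *\<^sub>R 1"
    using lm by (simp add: vec_eq_iff)
  then have a'w: "a' \<bullet> w = l * (a \<bullet> w)" if "w \<in> Wbar" for w
    using that by (simp add: inner_add_left Wbar_eq_inner)
  have "F \<noteq> {}" "F \<noteq> ?P" using facet by (auto simp: facet_of_def)
  then obtain x where x: "x \<in> F" by blast
  have "x \<in> ?P" "a \<bullet> x = c" using x unfolding a(4) by auto
  moreover have "a' \<bullet> x = c'" using x unfolding a'(4) by auto
  ultimately have c': "c' = l * c"
    using a'w[of x] corner_subset_Wbar[of M] by auto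
  \<comment> \<open>A point of the polyhedron off the facet fixes the sign of the multiple.\<close>
  obtain y where y: "y \<in> ?P" "y \<notin> F" using \<open>F \<noteq> ?P\<close> a(4) by blast
  then have "a \<bullet> y > c" "l * (a \<bullet> y) \<ge> l * c" "y \<in> Wbar"
    using sub a(4) a'(2,3) a'w[of y] c' corner_subset_Wbar[of M] by force+
  then have "l \<ge> 0" by (metis mult_less_cancel_left_disj not_le)
  moreover have "l \<noteq> 0" using a'(1) a'w by auto
  ultimately have "l > 0" by simp
  then show ?thesis
    unfolding a(2) a'(2) c' by (auto simp: a'w)
qed

section \<open>Deciding which candidate halfspaces occur\<close>

definition facet_halfspaces ::
  "'k::field ^ 'n::{finite,linorder} ^ 'n::{finite,linorder} \<Rightarrow> (real ^ 'n::{finite,linorder}) set set" where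
  "facet_halfspaces M =
    {H. \<exists>F. F facet_of corner_polyhedron M \<and> supporting_halfspace (corner_polyhedron M) F H}"

lemma s_halfspace_in_facet_halfspaces_iff:
  fixes M :: "'k::field ^ 'n::{finite,linorder} ^ 'n::{finite,linorder}"
  assumes "I \<subseteq> {1..<CARD('n)}" "I \<noteq> {}"
  shows "s_halfspace I c \<in> facet_halfspaces M \<longleftrightarrow>
    corner_polyhedron M \<subseteq> {w. step_normal I \<bullet> w \<ge> c} \<and>
    (corner_polyhedron M \<inter> {w. step_normal I \<bullet> w = c}) facet_of corner_polyhedron M"
  unfolding facet_halfspaces_def mem_Collect_eq supporting_s_halfspace_iff[OF assms corner_subset_Wbar]
  by auto

text \<open>The normal form leaves three families of candidates. Membership is kept as a condition
  on the right, to be replaced by a criterion for each family.\<close>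

lemma facet_halfspaces_eq:
  fixes M :: "'k::field ^ 'n::{finite,linorder} ^ 'n::{finite,linorder}"
  assumes "M \<noteq> 0"
  shows "facet_halfspaces M =
    {s_halfspace I 0 | I. I \<subseteq> {1..<CARD('n)} \<and> card I = 1 \<and> s_halfspace I 0 \<in> facet_halfspaces M} \<union>
    {s_halfspace I 1 | I. I \<subseteq> {1..<CARD('n)} \<and> I \<noteq> {} \<and> s_halfspace I 1 \<in> facet_halfspaces M} \<union>
    {s_halfspace I (- 1) | I. I \<subseteq> {1..<CARD('n)} \<and> I \<noteq> {} \<and> s_halfspace I (- 1) \<in> facet_halfspaces M}"
    (is "_ = ?R")
proof
  show "facet_halfspaces M \<subseteq> ?R"
  proof
    fix H assume H: "H \<in> facet_halfspaces M"
    then obtain F where "F facet_of corner_polyhedron M" "supporting_halfspace (corner_polyhedron M) F H"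
      unfolding facet_halfspaces_def by blast
    then obtain I c where I: "I \<subseteq> {1..<CARD('n)}" "I \<noteq> {}" "H = s_halfspace I c"
      "\<bar>c\<bar> = 1 \<or> c = 0 \<and> card I = 1"
      using facet_normal_form[OF assms] by metis
    then consider "c = 1" | "c = - 1" | "c = 0" "card I = 1" by linarith
    then show "H \<in> ?R"
      using H I by cases blast+
  qed
qed blast

lemma s_halfspace_0_facet_iff:
  fixes M :: "'k::field ^ 'n::{finite,linorder} ^ 'n::{finite,linorder}"
  assumes "M \<noteq> 0" "I \<subseteq> {1..<CARD('n)}" "card I = 1"
  shows "s_halfspace I 0 \<in> facet_halfspaces M \<longleftrightarrow>
    (\<forall>i j. M $ i $ j \<noteq> 0 \<longrightarrow> level I i \<le> level I j) \<and>
    (\<exists>i j. M $ i $ j \<noteq> 0 \<and> level I i = level I j)"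
proof -
  have I: "finite I" "I \<noteq> {}" using assms(3) by (auto intro: card_ge_0_finite)
  have "corner_polyhedron M \<subseteq> {w. step_normal I \<bullet> w \<ge> 0} \<longleftrightarrow>
      (\<forall>i j. M $ i $ j \<noteq> 0 \<longrightarrow> level I i \<le> level I j)"
    unfolding corner_subset_step_halfspace_iff[OF assms(1) I(1)] by simp
  then show ?thesis
    unfolding s_halfspace_in_facet_halfspaces_iff[OF assms(2) I(2)]
    using singleton_facet_iff[OF assms] by blast
qed

lemma s_halfspace_unit_facet_iff:
  fixes M :: "'k::field ^ 'n::{finite,linorder} ^ 'n::{finite,linorder}"
  assumes "M \<noteq> 0" "I \<subseteq> {1..<CARD('n)}" "I \<noteq> {}" "\<bar>c\<bar> = 1"
  shows "s_halfspace I c \<in> facet_halfspaces M \<longleftrightarrow>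
    (\<forall>i j. M $ i $ j \<noteq> 0 \<longrightarrow> c \<le> real (level I j) - real (level I i)) \<and>
    (\<forall>t\<in>{1..card I}. \<exists>i j. M $ i $ j \<noteq> 0 \<and> real (level I j) - real (level I i) = c \<and>
        max (level I i) (level I j) = t)"
proof -
  have "finite I" using assms(2) finite_subset by blast
  note sub = corner_subset_step_halfspace_iff[OF assms(1) this, of c]
  show ?thesis
    unfolding s_halfspace_in_facet_halfspaces_iff[OF assms(2,3)] sub[symmetric]
    by (intro conj_cong refl step_facet_iff assms)
qed

lemma level_mono:
  assumes "finite I" "i \<le> j"
  shows "level I i \<le> level I j"
proof -
  have "pos i \<le> pos j" using assms(2) by simp
  then have "{l\<in>I. l < pos i} \<subseteq> {l\<in>I. l < pos j}"
    using order.strict_trans2 by blast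
  then show ?thesis unfolding level_def using assms(1) by (intro card_mono) auto
qed

lemma strictly_upper_triangular_level_le:
  assumes "strictly_upper_triangular M" "finite I" "M $ i $ j \<noteq> 0"
  shows "level I i \<le> level I j"
proof -
  have "\<not> j \<le> i" using assms(1,3) unfolding strictly_upper_triangular_def by blast
  then show ?thesis using assms(2) by (intro level_mono) auto
qed

lemma not_strictly_upper_triangular_level_ge:
  assumes "\<not> strictly_upper_triangular M"
  obtains i j where "M $ i $ j \<noteq> 0" "\<And>I. finite I \<Longrightarrow> level I j \<le> level I i"
proof -
  obtain i j where "M $ i $ j \<noteq> 0" "j \<le> i"
    using assms unfolding strictly_upper_triangular_def by blast
  then show ?thesis by (intro that[of i j] level_mono)
qed

text \<open>An entry on or below the diagonal has row level at least its column level for every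
  \<open>I\<close>. It excludes the bound 1, and it is tight itself whenever the bound 0 is
  valid.\<close>

lemma facet_halfspaces_not_strictly_upper:
  fixes M :: "'k::field ^ 'n::{finite,linorder} ^ 'n::{finite,linorder}"
  assumes "M \<noteq> 0" and not_upper: "\<not> strictly_upper_triangular M"
  shows "facet_halfspaces M =
    {s_halfspace I 0 | I. I \<noteq> {} \<and> I \<subseteq> {1..<CARD('n)} \<and> card I = 1 \<and>
       (*v) M ` subflag I 1 \<subseteq> subflag I 1} \<union>
    {s_halfspace I (- 1) | I. I \<noteq> {} \<and> I \<subseteq> {1..<CARD('n)} \<and>
       (\<forall>t\<in>{1..card I}. hessenberg M I t = t + 1)}"
proof -
  obtain p q where pq: "M $ p $ q \<noteq> 0" "\<And>I. finite I \<Longrightarrow> level I q \<le> level I p"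
    using not_strictly_upper_triangular_level_ge[OF not_upper] by metis
  have zero: "s_halfspace I 0 \<in> facet_halfspaces M \<longleftrightarrow> (*v) M ` subflag I 1 \<subseteq> subflag I 1"
    if I: "I \<subseteq> {1..<CARD('n)}" "card I = 1" for I
  proof -
    have fin: "finite I" using I(1) finite_subset by blast
    have "level I i \<le> level I j \<longleftrightarrow> (level I j < 1 \<longrightarrow> level I i < 1)" for i j :: 'n
      using level_le[OF fin, of i] level_le[OF fin, of j] I(2) by auto
    then have "(*v) M ` subflag I 1 \<subseteq> subflag I 1 \<longleftrightarrow> (\<forall>i j. M $ i $ j \<noteq> 0 \<longrightarrow> level I i \<le> level I j)"
      unfolding image_subflag_subset_iff[OF I(1) le_add2 le_add2] by blast
    moreover have "level I p = level I q" if "\<forall>i j. M $ i $ j \<noteq> 0 \<longrightarrow> level I i \<le> level I j"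
      using that[rule_format, OF pq(1)] pq(2)[OF fin] by (rule antisym)
    ultimately show ?thesis
      unfolding s_halfspace_0_facet_iff[OF assms(1) I] using pq(1) by blast
  qed
  have plus: "s_halfspace I 1 \<notin> facet_halfspaces M" if I: "I \<subseteq> {1..<CARD('n)}" "I \<noteq> {}" for I
  proof -
    have "finite I" using I(1) finite_subset by blast
    from pq(2)[OF this] have "\<not> 1 \<le> real (level I q) - real (level I p)" by simp
    then show ?thesis
      unfolding s_halfspace_unit_facet_iff[OF assms(1) I abs_one] using pq(1) by blast
  qed
  have minus: "s_halfspace I (- 1) \<in> facet_halfspaces M \<longleftrightarrow>
      (\<forall>t\<in>{1..card I}. hessenberg M I t = t + 1)" if I: "I \<subseteq> {1..<CARD('n)}" "I \<noteq> {}" for I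
    unfolding hessenberg_succ_iff[OF I(1)] by (rule s_halfspace_unit_facet_iff[OF assms(1) I]) simp
  have "I \<subseteq> {1..<CARD('n)} \<and> card I = 1 \<and> s_halfspace I 0 \<in> facet_halfspaces M \<longleftrightarrow>
      I \<noteq> {} \<and> I \<subseteq> {1..<CARD('n)} \<and> card I = 1 \<and> (*v) M ` subflag I 1 \<subseteq> subflag I 1" for I
    using zero[of I] by (cases "I = {}") auto
  moreover have "I \<subseteq> {1..<CARD('n)} \<and> I \<noteq> {} \<and> s_halfspace I 1 \<in> facet_halfspaces M \<longleftrightarrow> False" for I
    using plus[of I] by blast
  moreover have "I \<subseteq> {1..<CARD('n)} \<and> I \<noteq> {} \<and> s_halfspace I (- 1) \<in> facet_halfspaces M \<longleftrightarrow>
      I \<noteq> {} \<and> I \<subseteq> {1..<CARD('n)} \<and> (\<forall>t\<in>{1..card I}. hessenberg M I t = t + 1)" for I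
    using minus[of I] by blast
  ultimately show ?thesis
    by (subst facet_halfspaces_eq[OF assms(1)])
      (simp only: simp_thms empty_def[symmetric] Un_empty_left Un_empty_right)
qed

text \<open>Row levels never exceed column levels, so the bound 0 is always valid and the bound
  \<open>- 1\<close> is never attained. With two levels, an entry is tight for 0 iff its row level
  is 1 or its column level is 0; these are the two alternatives of the criterion.\<close>

lemma facet_halfspaces_strictly_upper:
  fixes M :: "'k::field ^ 'n::{finite,linorder} ^ 'n::{finite,linorder}"
  assumes "M \<noteq> 0" and upper: "strictly_upper_triangular M"
  shows "facet_halfspaces M =
    {s_halfspace I 0 | I. I \<noteq> {} \<and> I \<subseteq> {1..<CARD('n)} \<and> card I = 1 \<and>
       (\<not> (*v) M ` std_flag CARD('n) \<subseteq> subflag I 1 \<or> (*v) M ` subflag I 1 \<noteq> {0})} \<union>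
    {s_halfspace I 1 | I. I \<noteq> {} \<and> I \<subseteq> {1..<CARD('n)} \<and>
       (\<forall>t\<in>{1..card I + 1}. hessenberg M I t = t - 1)}"
proof -
  have zero: "s_halfspace I 0 \<in> facet_halfspaces M \<longleftrightarrow>
      \<not> (*v) M ` std_flag CARD('n) \<subseteq> subflag I 1 \<or> (*v) M ` subflag I 1 \<noteq> {0}"
    if I: "I \<subseteq> {1..<CARD('n)}" "card I = 1" for I
  proof -
    have fin: "finite I" using I(1) finite_subset by blast
    have le: "level I i \<le> level I j" "level I j \<le> 1" if "M $ i $ j \<noteq> 0" for i j
      using strictly_upper_triangular_level_le[OF upper fin that] level_le[OF fin, of j] I(2) by auto
    have "subflag I 0 = {0 :: ('k, 'n) vec}"
      unfolding subflag_def using pos_le_subflag_index_iff[OF I(1), of 0]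
      by (auto simp: mem_std_flag_iff vec_eq_iff not_le)
    \<comment> \<open>The image contains 0, so being \<open>{0}\<close> is the same as lying in the
      zeroth subflag, a condition on levels.\<close>
    moreover have "0 \<in> (*v) M ` subflag I 1"
      by (rule image_eqI[of _ _ 0]) (auto simp: subflag_def mem_std_flag_iff)
    ultimately have "(*v) M ` subflag I 1 = {0} \<longleftrightarrow> (*v) M ` subflag I 1 \<subseteq> subflag I 0"
      by auto
    also have "\<dots> \<longleftrightarrow> \<not> (\<exists>i j. M $ i $ j \<noteq> 0 \<and> level I j < 1)"
      by (subst image_subflag_subset_iff[OF I(1)]) auto
    finally have img: "(*v) M ` subflag I 1 \<noteq> {0} \<longleftrightarrow> (\<exists>i j. M $ i $ j \<noteq> 0 \<and> level I j < 1)"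
      by blast
    have std: "(*v) M ` std_flag CARD('n) \<subseteq> subflag I 1 \<longleftrightarrow> \<not> (\<exists>i j. M $ i $ j \<noteq> 0 \<and> \<not> level I i < 1)"
      unfolding subflag_def image_std_flag_subset_iff
      using pos_le_subflag_index_iff[OF I(1), of 1] by (auto simp: pos_le_card)
    have mem: "s_halfspace I 0 \<in> facet_halfspaces M \<longleftrightarrow> (\<exists>i j. M $ i $ j \<noteq> 0 \<and> level I i = level I j)"
      unfolding s_halfspace_0_facet_iff[OF assms(1) I] using le(1) by blast
    have "level I i = level I j \<longleftrightarrow> \<not> level I i < 1 \<or> level I j < 1" if "M $ i $ j \<noteq> 0" for i j
      using le[OF that] by auto
    then show ?thesis
      unfolding mem img std not_not by blast
  qed
  have minus: "s_halfspace I (- 1) \<notin> facet_halfspaces M" if I: "I \<subseteq> {1..<CARD('n)}" "I \<noteq> {}" for I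
  proof
    have fin: "finite I" using I(1) finite_subset by blast
    then have "1 \<in> {1..card I}" using I(2) by (simp add: Suc_le_eq card_gt_0_iff)
    moreover assume "s_halfspace I (- 1) \<in> facet_halfspaces M"
    ultimately obtain i j where ij: "M $ i $ j \<noteq> 0" "real (level I j) - real (level I i) = - 1"
      using s_halfspace_unit_facet_iff[OF assms(1) I, of "- 1"] by fastforce
    then show False
      using strictly_upper_triangular_level_le[OF upper fin ij(1)] by simp
  qed
  have plus: "s_halfspace I 1 \<in> facet_halfspaces M \<longleftrightarrow>
      (\<forall>t\<in>{1..card I + 1}. hessenberg M I t = t - 1)" if I: "I \<subseteq> {1..<CARD('n)}" "I \<noteq> {}" for I
    unfolding hessenberg_pred_iff[OF I(1)] by (rule s_halfspace_unit_facet_iff[OF assms(1) I]) simp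
  have "I \<subseteq> {1..<CARD('n)} \<and> card I = 1 \<and> s_halfspace I 0 \<in> facet_halfspaces M \<longleftrightarrow>
      I \<noteq> {} \<and> I \<subseteq> {1..<CARD('n)} \<and> card I = 1 \<and> (\<not> (*v) M ` std_flag CARD('n) \<subseteq> subflag I 1 \<or> (*v) M ` subflag I 1 \<noteq> {0})" for I
    using zero[of I] by (cases "I = {}") auto
  moreover have "I \<subseteq> {1..<CARD('n)} \<and> I \<noteq> {} \<and> s_halfspace I (- 1) \<in> facet_halfspaces M \<longleftrightarrow> False" for I
    using minus[of I] by blast
  moreover have "I \<subseteq> {1..<CARD('n)} \<and> I \<noteq> {} \<and> s_halfspace I 1 \<in> facet_halfspaces M \<longleftrightarrow>
      I \<noteq> {} \<and> I \<subseteq> {1..<CARD('n)} \<and> (\<forall>t\<in>{1..card I + 1}. hessenberg M I t = t - 1)" for I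
    using plus[of I] by blast
  ultimately show ?thesis
    by (subst facet_halfspaces_eq[OF assms(1)])
      (simp only: simp_thms empty_def[symmetric] Un_empty_left Un_empty_right)
qed

theorem proposition3p22:
  fixes M :: "'k::alg_closed_field ^ 'n::{finite,linorder} ^ 'n::{finite,linorder}" and N :: nat
  assumes "N \<ge> 1" and "CARD('n) = N + 1" and "M \<noteq> 0"
  shows
    "(\<forall>F. F facet_of corner_polyhedron M \<longrightarrow>
        (\<exists>!H. supporting_halfspace (corner_polyhedron M) F H)) \<and>
     (\<forall>I. I \<noteq> {} \<and> I \<subseteq> {1..N} \<longrightarrow>
        (\<exists>\<^sub>\<le>\<^sub>1 F. F facet_of corner_polyhedron M \<and>
           (\<exists>c. supporting_halfspace (corner_polyhedron M) F (s_halfspace I c)))) \<and>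
     (\<not> strictly_upper_triangular M \<longrightarrow>
        {H. \<exists>F. F facet_of corner_polyhedron M \<and> supporting_halfspace (corner_polyhedron M) F H} =
          {s_halfspace I 0 | I. I \<noteq> {} \<and> I \<subseteq> {1..N} \<and> card I = 1 \<and>
             (*v) M ` subflag I 1 \<subseteq> subflag I 1} \<union>
          {s_halfspace I (- 1) | I. I \<noteq> {} \<and> I \<subseteq> {1..N} \<and>
             (\<forall>t\<in>{1..card I}. hessenberg M I t = t + 1)}) \<and>
     (strictly_upper_triangular M \<longrightarrow>
        {H. \<exists>F. F facet_of corner_polyhedron M \<and> supporting_halfspace (corner_polyhedron M) F H} =
          {s_halfspace I 0 | I. I \<noteq> {} \<and> I \<subseteq> {1..N} \<and> card I = 1 \<and>
             (\<not> (*v) M ` std_flag (N + 1) \<subseteq> subflag I 1 \<or> (*v) M ` subflag I 1 \<noteq> {0})} \<union>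
          {s_halfspace I 1 | I. I \<noteq> {} \<and> I \<subseteq> {1..N} \<and>
             (\<forall>t\<in>{1..card I + 1}. hessenberg M I t = t - 1)})"
proof (intro conjI allI impI)
  have N: "{1..N} = {1..<CARD('n)}" using assms(2) by auto
  show "\<exists>!H. supporting_halfspace (corner_polyhedron M) F H" if "F facet_of corner_polyhedron M" for F
    using facet_supporting_halfspace_exists[OF that] facet_supporting_halfspace_unique[OF assms(3) that]
    by blast
  show "\<exists>\<^sub>\<le>\<^sub>1 F. F facet_of corner_polyhedron M \<and>
      (\<exists>c. supporting_halfspace (corner_polyhedron M) F (s_halfspace I c))"
    if "I \<noteq> {} \<and> I \<subseteq> {1..N}" for I
    using supported_facet_unique[where I = I, OF _ _ corner_subset_Wbar[of M]] that
    unfolding N by (intro Uniq_I) (metis facet_of_def)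
  show "{H. \<exists>F. F facet_of corner_polyhedron M \<and> supporting_halfspace (corner_polyhedron M) F H} =
          {s_halfspace I 0 | I. I \<noteq> {} \<and> I \<subseteq> {1..N} \<and> card I = 1 \<and>
             (*v) M ` subflag I 1 \<subseteq> subflag I 1} \<union>
          {s_halfspace I (- 1) | I. I \<noteq> {} \<and> I \<subseteq> {1..N} \<and>
             (\<forall>t\<in>{1..card I}. hessenberg M I t = t + 1)}"
    if "\<not> strictly_upper_triangular M"
    using facet_halfspaces_not_strictly_upper[OF assms(3) that] unfolding N facet_halfspaces_def .
  show "{H. \<exists>F. F facet_of corner_polyhedron M \<and> supporting_halfspace (corner_polyhedron M) F H} =
          {s_halfspace I 0 | I. I \<noteq> {} \<and> I \<subseteq> {1..N} \<and> card I = 1 \<and>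
             (\<not> (*v) M ` std_flag (N + 1) \<subseteq> subflag I 1 \<or> (*v) M ` subflag I 1 \<noteq> {0})} \<union>
          {s_halfspace I 1 | I. I \<noteq> {} \<and> I \<subseteq> {1..N} \<and>
             (\<forall>t\<in>{1..card I + 1}. hessenberg M I t = t - 1)}"
    if "strictly_upper_triangular M"
    using facet_halfspaces_strictly_upper[OF assms(3) that]
    unfolding N assms(2)[symmetric] facet_halfspaces_def .
qed

end
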